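(* Let $(\Gamma,\alpha)$ be a $d$-valent abstract one-skeleton which is 3-independent and non-cyclic. Let $\xi\in\mathcal P$ be a polarizing vector and let $\phi:V_\Gamma\to\mathbb R$ be $\xi$-compatible. If $p\in V_\Gamma$ is a vertex of index $r$ (with respect to $\xi$), then there exists an element $\tau_p\in H^{2r}(\Gamma,\alpha)$ such that: 1. $\tau_p$ is supported on $F_p$; 2. $\tau_p(p)=\prod\alpha_e$, the product over the edges $e\in E_p$ with $\alpha_e(\xi)<0$.
   Context: $\mathfrak g$ is an $n$-dimensional real vector space, $\mathfrak g^*$ its dual, $\mathbb S(\mathfrak g^* )=\bigoplus_k\mathbb S^k(\mathfrak g^* )$ the symmetric algebra (polynomial functions on $\mathfrak g$). Abstract one-skeleton: a finite $d$-valent graph $\Gamma$ (multiple edges allowed) with vertex set $V_\Gamma$ and set $E_\Gamma$ of oriented edges (each edge occurs with both orientations; $i(e),t(e)$ are the initial and terminal vertices of $e$, $\bar e$ is $e$ reversed, $E_p=\{e: i(e)=p\}$ has $d$ elements), a connection $\theta$, i.e. bijections $\theta_e:E_{i(e)}\to E_{t(e)}$ with $\theta_{\bar e}=\theta_e^{-1}$, and an axial function $\alpha:E_\Gamma\to\mathfrak g^*$ such that: (A1) for every $p$ the vectors $\alpha_e$, $e\in E_p$, are pairwise linearly independent; (A2) for every $e$ there are positive numbers $m_e,m_{\bar e}$ with $m_{\bar e}\alpha_{\bar e}=-m_e\alpha_e$; (A3) for every $e\in E_\Gamma$ and $e_i\in E_{i(e)}$, $\alpha_{\theta_e(e_i)}=\lambda_{i,e}\alpha_{e_i}+c_{i,e}\alpha_e$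 with $\lambda_{i,e}>0$, $c_{i,e}\in\mathbb R$. 3-independent: for every vertex $p$ and any three distinct edges in $E_p$, the three values of $\alpha$ are linearly independent. Polarizing vectors: $\mathcal P=\{\xi\in\mathfrak g:\alpha_e(\xi)\ne0\ \forall e\in E_\Gamma\}$. For $\xi\in\mathcal P$ the index of a vertex $p$ is the number of $e\in E_p$ with $\alpha_e(\xi)<0$; $b_{2i}(\Gamma)$ is the number of vertices of index $i$; this is independent of $\xi\in\mathcal P$. The same definitions apply to a connected component of a subgraph $\Gamma_{\mathfrak h}$ (below) using its own edges. A function $\phi:V_\Gamma\to\mathbb R$ is $\xi$-compatible if $\phi(t(e))>\phi(i(e))$ for every $e\in E_\Gamma$ with $\alpha_e(\xi)>0$. The flow-out $F_p$ is the set of vertices (including $p$) that can be reached from $p$ by a path of oriented edges $e$ with $\alpha_e(\xi)>0$. For a subspace $\mathfrak h\subset\mathfrak g$, $\Gamma_{\mathfrak h}$ is the subgraph whose edges are those $e$ with $\alpha_e\in\mathfrak h^\perp$ (annihilator of $\mathfrak h$). Non-cyclic: (NCA1) for some $\xi\in\mathcal P$, the graph $\Gamma$ with each edge oriented so that $\alpha_e(\xi)>0$ has no oriented cycles; (NCA2) for every codimension 2 subspace $\mathfrak h$ of $\mathfrak g$, every connected component $\Gamma_0$ of $\Gamma_{\mathfrak h}$ has $b_0(\Gamma_0)=1$. Cohomology ring: $H(\Gamma,\alpha)$ is the ring of maps $f:V_\Gamma\to\mathbb S(\mathfrak g^* )$ such that $f(i(e))-f(t(e))\in\alpha_e\,\mathbb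 S(\mathfrak g^* )$ for every $e\in E_\Gamma$; $H^{2m}(\Gamma,\alpha)$ is the subspace of those $f$ with values in $\mathbb S^m(\mathfrak g^* )$. *)

theory Defs
  imports "HOL-Analysis.Analysis" "Graph_Theory.Graph_Theory"
begin

text \<open>
  The vector space is the type \<open>'g :: euclidean_space\<close>; its inner product is never used.
  Its dual is \<open>'g \<Rightarrow>\<^sub>L real\<close>: in finite dimension every linear functional is bounded.
  Elements of the symmetric algebra of the dual are identified with the polynomial functions
  they define, which loses nothing over the infinite field of reals.
\<close>

definition sym_alg :: "('g::euclidean_space \<Rightarrow> real) set" where
  "sym_alg = {f. real_polynomial_function f}"

definition sym_pow :: "nat \<Rightarrow> ('g::euclidean_space \<Rightarrow> real) set" where
  "sym_pow m = {f \<in> sym_alg. \<forall>c x. f (c *\<^sub>R x) = c ^ m * f x}"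

text \<open>Linear independence of the family \<open>(\<alpha> e)\<close>, \<open>e \<in> S\<close>; without injectivity repeated
  vectors would be allowed.\<close>

definition indep_on :: "('e \<Rightarrow> 'a::real_vector) \<Rightarrow> 'e set \<Rightarrow> bool" where
  "indep_on \<alpha> S \<longleftrightarrow> inj_on \<alpha> S \<and> independent (\<alpha> ` S)"

text \<open>
  The arcs of \<open>\<Gamma>\<close> are the oriented edges, \<open>arev\<close> reverses them, \<open>tail\<close> and \<open>head\<close> are the
  initial and terminal vertices, and \<open>out_arcs \<Gamma> p\<close> is the set of edges issuing from \<open>p\<close>.
  Parallel edges are allowed. The maps \<open>\<theta> e\<close> and \<open>\<alpha>\<close> matter only on arcs of \<open>\<Gamma>\<close>;
  outside them \<open>arev\<close> is the identity by the convention of \<open>bidirected_digraph\<close>.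
\<close>

locale one_skeleton = fin_digraph \<Gamma> + bidirected_digraph \<Gamma> arev
  for \<Gamma> :: "('v, 'e) pre_digraph" and arev :: "'e \<Rightarrow> 'e" +
  fixes d :: nat
    and \<theta> :: "'e \<Rightarrow> 'e \<Rightarrow> 'e"
    and \<alpha> :: "'e \<Rightarrow> 'g::euclidean_space \<Rightarrow>\<^sub>L real"
  assumes valent: "p \<in> verts \<Gamma> \<Longrightarrow> card (out_arcs \<Gamma> p) = d"
    and connection_bij:
      "e \<in> arcs \<Gamma> \<Longrightarrow> bij_betw (\<theta> e) (out_arcs \<Gamma> (tail \<Gamma> e)) (out_arcs \<Gamma> (head \<Gamma> e))"
    and connection_arev:
      "\<lbrakk>e \<in> arcs \<Gamma>; e' \<in> out_arcs \<Gamma> (tail \<Gamma> e)\<rbrakk> \<Longrightarrow> \<theta> (arev e) (\<theta> e e') = e'"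
    and A1: "\<lbrakk>p \<in> verts \<Gamma>; e \<in> out_arcs \<Gamma> p; e' \<in> out_arcs \<Gamma> p; e \<noteq> e'\<rbrakk>
      \<Longrightarrow> indep_on \<alpha> {e, e'}"
    and A2: "e \<in> arcs \<Gamma> \<Longrightarrow> \<exists>m>0. \<exists>m'>0. m' *\<^sub>R \<alpha> (arev e) = - (m *\<^sub>R \<alpha> e)"
    and A3: "\<lbrakk>e \<in> arcs \<Gamma>; e' \<in> out_arcs \<Gamma> (tail \<Gamma> e)\<rbrakk>
      \<Longrightarrow> \<exists>l>0. \<exists>c. \<alpha> (\<theta> e e') = l *\<^sub>R \<alpha> e' + c *\<^sub>R \<alpha> e"

definition three_independent ::
    "('v, 'e) pre_digraph \<Rightarrow> ('e \<Rightarrow> 'g::euclidean_space \<Rightarrow>\<^sub>L real) \<Rightarrow> bool" where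
  "three_independent \<Gamma> \<alpha> \<longleftrightarrow>
    (\<forall>p \<in> verts \<Gamma>. \<forall>S \<subseteq> out_arcs \<Gamma> p. card S = 3 \<longrightarrow> indep_on \<alpha> S)"

definition polarizing ::
    "('v, 'e) pre_digraph \<Rightarrow> ('e \<Rightarrow> 'g::euclidean_space \<Rightarrow>\<^sub>L real) \<Rightarrow> 'g set" where
  "polarizing \<Gamma> \<alpha> = {\<xi>. \<forall>e \<in> arcs \<Gamma>. blinfun_apply (\<alpha> e) \<xi> \<noteq> 0}"

definition descending ::
    "('v, 'e) pre_digraph \<Rightarrow> ('e \<Rightarrow> 'g::euclidean_space \<Rightarrow>\<^sub>L real) \<Rightarrow> 'g \<Rightarrow> 'v \<Rightarrow> 'e set" where
  "descending \<Gamma> \<alpha> \<xi> p = {e \<in> out_arcs \<Gamma> p. blinfun_apply (\<alpha> e) \<xi> < 0}"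

definition index ::
    "('v, 'e) pre_digraph \<Rightarrow> ('e \<Rightarrow> 'g::euclidean_space \<Rightarrow>\<^sub>L real) \<Rightarrow> 'g \<Rightarrow> 'v \<Rightarrow> nat" where
  "index \<Gamma> \<alpha> \<xi> p = card (descending \<Gamma> \<alpha> \<xi> p)"

text \<open>\<open>even_betti \<Gamma> \<alpha> i\<close> is the Betti number with subscript \<open>2 * i\<close>. For a one-skeleton, and for
  the components of the subgraphs \<open>annihilated\<close> below, the count does not depend on which
  polarizing vector is chosen.\<close>

definition even_betti ::
    "('v, 'e) pre_digraph \<Rightarrow> ('e \<Rightarrow> 'g::euclidean_space \<Rightarrow>\<^sub>L real) \<Rightarrow> nat \<Rightarrow> nat" where
  "even_betti \<Gamma> \<alpha> i =
    card {p \<in> verts \<Gamma>. index \<Gamma> \<alpha> (SOME \<xi>. \<xi> \<in> polarizing \<Gamma> \<alpha>) p = i}"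

definition ascending ::
    "('v, 'e) pre_digraph \<Rightarrow> ('e \<Rightarrow> 'g::euclidean_space \<Rightarrow>\<^sub>L real) \<Rightarrow> 'g \<Rightarrow> ('v, 'e) pre_digraph" where
  "ascending \<Gamma> \<alpha> \<xi> = \<Gamma>\<lparr>arcs := {e \<in> arcs \<Gamma>. blinfun_apply (\<alpha> e) \<xi> > 0}\<rparr>"

definition compatible_height ::
    "('v, 'e) pre_digraph \<Rightarrow> ('e \<Rightarrow> 'g::euclidean_space \<Rightarrow>\<^sub>L real) \<Rightarrow> 'g \<Rightarrow> ('v \<Rightarrow> real) \<Rightarrow> bool" where
  "compatible_height \<Gamma> \<alpha> \<xi> \<phi> \<longleftrightarrow>
    (\<forall>e \<in> arcs \<Gamma>. blinfun_apply (\<alpha> e) \<xi> > 0 \<longrightarrow> \<phi> (head \<Gamma> e) > \<phi> (tail \<Gamma> e))"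

definition flow_out ::
    "('v, 'e) pre_digraph \<Rightarrow> ('e \<Rightarrow> 'g::euclidean_space \<Rightarrow>\<^sub>L real) \<Rightarrow> 'g \<Rightarrow> 'v \<Rightarrow> 'v set" where
  "flow_out \<Gamma> \<alpha> \<xi> p = {q. p \<rightarrow>\<^sup>*\<^bsub>ascending \<Gamma> \<alpha> \<xi>\<^esub> q}"

text \<open>All vertices are kept, so a vertex on no annihilated edge is a component by itself;
  its zeroth Betti number is 1.\<close>

definition annihilated ::
    "('v, 'e) pre_digraph \<Rightarrow> ('e \<Rightarrow> 'g::euclidean_space \<Rightarrow>\<^sub>L real) \<Rightarrow> 'g set \<Rightarrow> ('v, 'e) pre_digraph" where
  "annihilated \<Gamma> \<alpha> H = \<Gamma>\<lparr>arcs := {e \<in> arcs \<Gamma>. \<forall>x \<in> H. blinfun_apply (\<alpha> e) x = 0}\<rparr>"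

text \<open>Every edge of an \<open>annihilated\<close> subgraph of a one-skeleton occurs in it with both
  orientations, so its connected components are its strongly connected components.\<close>

definition non_cyclic ::
    "('v, 'e) pre_digraph \<Rightarrow> ('e \<Rightarrow> 'g::euclidean_space \<Rightarrow>\<^sub>L real) \<Rightarrow> bool" where
  "non_cyclic \<Gamma> \<alpha> \<longleftrightarrow>
    (\<exists>\<xi> \<in> polarizing \<Gamma> \<alpha>. \<nexists>w. pre_digraph.cycle (ascending \<Gamma> \<alpha> \<xi>) w) \<and>
    (\<forall>H. subspace H \<and> dim H + 2 = DIM('g) \<longrightarrow>
      (\<forall>\<Gamma>\<^sub>0 \<in> pre_digraph.sccs (annihilated \<Gamma> \<alpha> H). even_betti \<Gamma>\<^sub>0 \<alpha> 0 = 1))"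

definition cohomology ::
    "('v, 'e) pre_digraph \<Rightarrow> ('e \<Rightarrow> 'g::euclidean_space \<Rightarrow>\<^sub>L real) \<Rightarrow> ('v \<Rightarrow> 'g \<Rightarrow> real) set" where
  "cohomology \<Gamma> \<alpha> = {f \<in> verts \<Gamma> \<rightarrow>\<^sub>E sym_alg.
    \<forall>e \<in> arcs \<Gamma>. \<exists>g \<in> sym_alg.
      \<forall>x. f (tail \<Gamma> e) x - f (head \<Gamma> e) x = blinfun_apply (\<alpha> e) x * g x}"

text \<open>\<open>even_cohomology \<Gamma> \<alpha> m\<close> is the graded piece with superscript \<open>2 * m\<close>.\<close>

definition even_cohomology ::
    "('v, 'e) pre_digraph \<Rightarrow> ('e \<Rightarrow> 'g::euclidean_space \<Rightarrow>\<^sub>L real) \<Rightarrow> nat \<Rightarrow> ('v \<Rightarrow> 'g \<Rightarrow> real) set" where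
  "even_cohomology \<Gamma> \<alpha> m = {f \<in> cohomology \<Gamma> \<alpha>. \<forall>p \<in> verts \<Gamma>. f p \<in> sym_pow m}"

end

theory Submission
  imports Defs "HOL-Computational_Algebra.Polynomial"
begin

text \<open>
  The class is built vertex by vertex in order of increasing height. At a vertex \<open>q\<close> one needs a
  polynomial with prescribed restrictions to the kernels of the descending \<open>\<alpha> e\<close>. By
  3-independence such a polynomial exists as soon as the prescribed restrictions agree on pairwise
  intersections, by successive division by linear forms; taking a homogeneous component gives the
  right degree. For two descending edges at \<open>q\<close> the agreement is automatic: the component
  through \<open>q\<close> of the subgraph annihilated by their common kernel has a single local minimum, the
  values already constructed are constant on the common kernel along a descending path in it, and
  both descents from \<open>q\<close> end at that minimum.

  Non-cyclicity gives a single local minimum only for some choice of polarizing vector. The number of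
  local minima does not depend on that choice, since it is locally constant in the polarizing vector
  off a codimension 2 subspace, whose complement is connected: at the wall of an edge the
  connection matches the remaining edges at its two endpoints with equal signs.
\<close>

section \<open>Pairs of linear functionals\<close>

text \<open>Subtracting a suitable multiple of a vector \<open>u\<close> with
  \<open>a u \<noteq> 0\<close> moves any \<open>x\<close> into the kernel of \<open>a\<close>, so
  \<open>a\<close> and the value \<open>b u\<close> determine \<open>b\<close>.\<close>

lemma functional_in_span1:
  fixes a b :: "'g::real_normed_vector \<Rightarrow>\<^sub>L real"
  assumes "a \<noteq> 0" "\<And>x. a x = 0 \<Longrightarrow> b x = 0"
  obtains c where "b = c *\<^sub>R a"
proof -
  obtain u where u: "a u \<noteq> 0"
    using assms(1) by (metis blinfun_eqI zero_blinfun.rep_eq)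
  have "b x = (b u / a u) * a x" for x
  proof -
    have "a (x - (a x / a u) *\<^sub>R u) = 0"
      using u by (simp add: blinfun.diff_right blinfun.scaleR_right)
    then have "b (x - (a x / a u) *\<^sub>R u) = 0"
      by (rule assms(2))
    then show ?thesis
      by (simp add: blinfun.diff_right blinfun.scaleR_right)
  qed
  then obtain c where "\<And>x. b x = c * a x"
    by blast
  then have "b = c *\<^sub>R a"
    by (intro blinfun_eqI) (simp add: scaleR_blinfun.rep_eq)
  then show ?thesis ..
qed

lemma exists_dual_vector:
  fixes a b :: "'g::real_normed_vector \<Rightarrow>\<^sub>L real"
  assumes "a \<noteq> 0" "\<And>c. b \<noteq> c *\<^sub>R a"
  obtains u where "a u = 0" "b u = 1"
proof -
  have "\<exists>v. a v = 0 \<and> b v \<noteq> 0"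
  proof (rule ccontr)
    assume "\<nexists>v. a v = 0 \<and> b v \<noteq> 0"
    then have "b x = 0" if "a x = 0" for x
      using that by simp
    then obtain c where "b = c *\<^sub>R a"
      by (rule functional_in_span1[OF assms(1)])
    with assms(2)[of c] show False by (rule notE)
  qed
  then obtain v where v: "a v = 0" "b v \<noteq> 0" by blast
  show ?thesis
    using v by (intro that[of "v /\<^sub>R b v"]) (simp_all add: blinfun.scaleR_right)
qed

text \<open>The dual pair \<open>u\<close>, \<open>v\<close> gives coordinates transverse to the
  common kernel of \<open>a\<close> and \<open>b\<close>, from which the arguments about that kernel
  start. Excluding multiples in both directions also excludes zero functionals.\<close>

lemma exists_dual_basis:
  fixes a b :: "'g::real_normed_vector \<Rightarrow>\<^sub>L real"
  assumes "\<And>c. a \<noteq> c *\<^sub>R b" "\<And>c. b \<noteq> c *\<^sub>R a"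
  obtains u v where "a u = 1" "b u = 0" "a v = 0" "b v = 1"
proof -
  have "a \<noteq> 0"
    using assms(1)[of 0] by simp
  have "b \<noteq> 0"
    using assms(2)[of 0] by simp
  obtain u where "b u = 0" "a u = 1"
    using exists_dual_vector[OF \<open>b \<noteq> 0\<close> assms(1)] .
  moreover obtain v where "a v = 0" "b v = 1"
    using exists_dual_vector[OF \<open>a \<noteq> 0\<close> assms(2)] .
  ultimately show ?thesis
    using that by blast
qed

lemma functional_in_span2:
  fixes a b f :: "'g::real_normed_vector \<Rightarrow>\<^sub>L real"
  assumes uv: "a u = 1" "b u = 0" "a v = 0" "b v = 1"
    and f: "\<And>x. a x = 0 \<Longrightarrow> b x = 0 \<Longrightarrow> f x = 0"
  shows "f = f u *\<^sub>R a + f v *\<^sub>R b"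
proof (rule blinfun_eqI)
  fix x
  have "f (x - a x *\<^sub>R u - b x *\<^sub>R v) = 0"
    by (rule f) (simp_all add: uv blinfun.diff_right blinfun.scaleR_right)
  then show "f x = (f u *\<^sub>R a + f v *\<^sub>R b) x"
    by (simp add: blinfun.diff_right blinfun.scaleR_right plus_blinfun.rep_eq
        scaleR_blinfun.rep_eq mult.commute)
qed

text \<open>This places the common kernel of two edges among the subspaces quantified over in
  \<open>non_cyclic\<close>. Adjoining \<open>v\<close> and then \<open>u\<close> raises the
  dimension by one each time and exhausts the space.\<close>

lemma dim_common_kernel:
  fixes a b :: "'g::euclidean_space \<Rightarrow>\<^sub>L real"
  assumes uv: "a u = 1" "b u = 0" "a v = 0" "b v = 1"
  defines "H \<equiv> {x. a x = 0 \<and> b x = 0}"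
  shows "subspace H" "dim H + 2 = DIM('g)"
proof -
  show sub: "subspace H"
    by (auto simp: H_def subspace_def blinfun.add_right blinfun.scaleR_right)
  have "v \<notin> span H"
    using uv sub by (simp add: span_eq_iff[THEN iffD2] H_def)
  moreover have "subspace {x. a x = 0}"
    by (auto simp: subspace_def blinfun.add_right blinfun.scaleR_right)
  then have "span (insert v H) \<subseteq> {x. a x = 0}"
    using uv by (intro span_minimal) (auto simp: H_def)
  then have "u \<notin> span (insert v H)"
    using uv by auto
  ultimately have "dim (insert u (insert v H)) = dim H + 2"
    by (simp add: dim_insert)
  moreover have "x \<in> span (insert u (insert v H))" for x
  proof -
    have "x - a x *\<^sub>R u - b x *\<^sub>R v \<in> H"
      by (simp add: H_def uv blinfun.diff_right blinfun.scaleR_right)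
    then have "(x - a x *\<^sub>R u - b x *\<^sub>R v) + a x *\<^sub>R u + b x *\<^sub>R v \<in> span (insert u (insert v H))"
      by (intro span_add span_scale span_base) auto
    then show ?thesis by simp
  qed
  then have "span (insert u (insert v H)) = UNIV" by auto
  then have "dim (insert u (insert v H)) = DIM('g)"
    by (metis dim_span dim_UNIV)
  ultimately show "dim H + 2 = DIM('g)" by simp
qed

text \<open>In the coordinates given by \<open>u\<close> and \<open>v\<close> the complement is a
  punctured plane times the common kernel, and a punctured plane, unlike a punctured line, is
  connected.\<close>

lemma connected_complement_common_kernel:
  fixes a b :: "'g::euclidean_space \<Rightarrow>\<^sub>L real"
  assumes uv: "a u = 1" "b u = 0" "a v = 0" "b v = 1"
  shows "Topological_Spaces.connected {x. \<not> (a x = 0 \<and> b x = 0)}"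
proof -
  define H where "H = {x. a x = 0 \<and> b x = 0}"
  define L where "L = (\<lambda>(z :: real \<times> real, w). fst z *\<^sub>R u + snd z *\<^sub>R v + w)"
  have "subspace H"
    using dim_common_kernel(1)[OF uv] by (simp add: H_def)
  then have "Topological_Spaces.connected ((- {0 :: real \<times> real}) \<times> H)"
    by (intro connected_Times connected_punctured_universe convex_connected subspace_imp_convex) simp
  moreover have "continuous_on ((- {0 :: real \<times> real}) \<times> H) L"
    unfolding L_def case_prod_unfold by (intro continuous_intros)
  ultimately have "Topological_Spaces.connected (L ` ((- {0}) \<times> H))"
    using connected_continuous_image by blast
  moreover have "L ` ((- {0}) \<times> H) = {x. \<not> (a x = 0 \<and> b x = 0)}"
  proof (intro set_eqI iffI)
    fix x assume "x \<in> L ` ((- {0}) \<times> H)"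
    then show "x \<in> {x. \<not> (a x = 0 \<and> b x = 0)}"
      by (auto simp: L_def H_def uv blinfun.add_right blinfun.scaleR_right zero_prod_def)
  next
    fix x assume "x \<in> {x. \<not> (a x = 0 \<and> b x = 0)}"
    then show "x \<in> L ` ((- {0}) \<times> H)"
      by (intro image_eqI[where x = "((a x, b x), x - a x *\<^sub>R u - b x *\<^sub>R v)"])
        (auto simp: L_def H_def uv blinfun.diff_right blinfun.scaleR_right zero_prod_def)
  qed
  ultimately show ?thesis by simp
qed

section \<open>Independence of two and three axial vectors\<close>

lemma indep_on_not_in_span:
  assumes "indep_on \<alpha> S" "e \<in> S" "T \<subseteq> S - {e}"
  shows "\<alpha> e \<notin> span (\<alpha> ` T)"
proof -
  have "\<alpha> ` T \<subseteq> \<alpha> ` S - {\<alpha> e}"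
    using assms by (auto simp: indep_on_def inj_on_def)
  moreover have "\<alpha> e \<notin> span (\<alpha> ` S - {\<alpha> e})"
    using assms by (auto simp: indep_on_def dependent_def)
  ultimately show ?thesis
    using span_mono by blast
qed

lemma indep_on_pairD:
  assumes "indep_on \<alpha> {e, e'}" "e \<noteq> e'"
  shows "\<alpha> e \<noteq> c *\<^sub>R \<alpha> e'"
  using indep_on_not_in_span[OF assms(1), of e "{e'}"] assms(2) by (auto simp: span_singleton)

lemma indep_on_tripleD:
  assumes "indep_on \<alpha> {e, e', e''}" "e \<noteq> e'" "e \<noteq> e''"
  shows "\<alpha> e \<noteq> c *\<^sub>R \<alpha> e' + c' *\<^sub>R \<alpha> e''"
proof -
  have "\<alpha> e \<notin> span (\<alpha> ` {e', e''})"
    using indep_on_not_in_span[OF assms(1), of e "{e', e''}"] assms(2,3) by auto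
  moreover have "c *\<^sub>R \<alpha> e' + c' *\<^sub>R \<alpha> e'' \<in> span (\<alpha> ` {e', e''})"
    by (intro span_add span_scale span_base) auto
  ultimately show ?thesis by metis
qed

section \<open>Polynomial functions on hyperplanes\<close>

lemma real_polynomial_function_blinfun [intro]:
  "real_polynomial_function (blinfun_apply a)"
  by (rule real_polynomial_function.intros(1)) (rule blinfun.bounded_linear_right)

lemma real_polynomial_function_comp_linear:
  assumes "real_polynomial_function f" "bounded_linear P"
  shows "real_polynomial_function (\<lambda>x. f (P x))"
  using real_polynomial_function_compose[OF polynomial_function_bounded_linear[OF assms(2)] assms(1)]
  by (simp add: o_def)

lemma bounded_linear_project_along:
  fixes a :: "'g::euclidean_space \<Rightarrow>\<^sub>L real"
  shows "bounded_linear (\<lambda>x. x - a x *\<^sub>R u)"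
  by (intro bounded_linear_intros)

text \<open>When \<open>a u = 1\<close>, the map subtracting \<open>a x *\<^sub>R u\<close> is the
  projection onto the kernel of \<open>a\<close>, so a polynomial is its restriction to that kernel,
  pulled back, plus a multiple of \<open>a\<close>. The proof follows the generation of polynomials
  from linear functions and constants.\<close>

lemma divisible_along:
  fixes a :: "'g::euclidean_space \<Rightarrow>\<^sub>L real"
  assumes "real_polynomial_function f"
  shows "\<exists>g. real_polynomial_function g \<and> (\<forall>x. f x - f (x - a x *\<^sub>R u) = a x * g x)"
  using assms
proof (induction f rule: real_polynomial_function.induct)
  case (linear f)
  then have "f x - f (x - a x *\<^sub>R u) = a x * f u" for x
    by (simp add: linear_simps)
  then show ?case
    by (intro exI[of _ "\<lambda>x. f u"]) auto
next
  case (const c)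
  then show ?case
    by (intro exI[of _ "\<lambda>x. 0"]) auto
next
  case (add f g)
  from add.IH(1) obtain f' where f': "real_polynomial_function f'"
    "\<And>x. f x - f (x - a x *\<^sub>R u) = a x * f' x" by blast
  from add.IH(2) obtain g' where g': "real_polynomial_function g'"
    "\<And>x. g x - g (x - a x *\<^sub>R u) = a x * g' x" by blast
  have "f x + g x - (f (x - a x *\<^sub>R u) + g (x - a x *\<^sub>R u)) = a x * (f' x + g' x)" for x
    using f'(2)[of x] g'(2)[of x] by (simp add: distrib_left)
  then show ?case
    using real_polynomial_function.intros(3)[OF f'(1) g'(1)] by blast
next
  case (mult f g)
  from mult.IH(1) obtain f' where f': "real_polynomial_function f'"
    "\<And>x. f x - f (x - a x *\<^sub>R u) = a x * f' x" by blast
  from mult.IH(2) obtain g' where g': "real_polynomial_function g'"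
    "\<And>x. g x - g (x - a x *\<^sub>R u) = a x * g' x" by blast
  have "f x * g x - f (x - a x *\<^sub>R u) * g (x - a x *\<^sub>R u)
      = a x * (f' x * g x + f (x - a x *\<^sub>R u) * g' x)" for x
  proof -
    \<comment> \<open>Product rule for differences: one factor is changed at a time.\<close>
    have "f x * g x - f (x - a x *\<^sub>R u) * g (x - a x *\<^sub>R u)
      = (f x - f (x - a x *\<^sub>R u)) * g x + f (x - a x *\<^sub>R u) * (g x - g (x - a x *\<^sub>R u))"
      by (simp add: algebra_simps)
    then show ?thesis
      by (simp add: f' g' algebra_simps)
  qed
  moreover have "real_polynomial_function (\<lambda>x. f' x * g x + f (x - a x *\<^sub>R u) * g' x)"
    using mult f' g' real_polynomial_function_comp_linear[OF mult.hyps(1) bounded_linear_project_along]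
    by (intro real_polynomial_function.intros(3,4))
  ultimately show ?case by blast
qed

text \<open>The factor theorem for a linear form: projecting along \<open>v /\<^sub>R a v\<close>,
  where \<open>a\<close> takes the value 1, lands in the kernel of \<open>a\<close>, where
  \<open>f\<close> vanishes.\<close>

lemma divisible_by_functional:
  fixes a :: "'g::euclidean_space \<Rightarrow>\<^sub>L real"
  assumes "a \<noteq> 0" "real_polynomial_function f" "\<And>x. a x = 0 \<Longrightarrow> f x = 0"
  obtains g where "real_polynomial_function g" "\<And>x. f x = a x * g x"
proof -
  obtain v where "a v \<noteq> 0"
    using assms(1) by (metis blinfun_eqI zero_blinfun.rep_eq)
  then have u: "a (v /\<^sub>R a v) = 1"
    by (simp add: blinfun.scaleR_right)
  obtain g where g: "real_polynomial_function g"
    "\<And>x. f x - f (x - a x *\<^sub>R (v /\<^sub>R a v)) = a x * g x"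
    using divisible_along[OF assms(2), of a "v /\<^sub>R a v"] by blast
  have "f (x - a x *\<^sub>R (v /\<^sub>R a v)) = 0" for x
    using u by (intro assms(3)) (simp only: blinfun.diff_right blinfun.scaleR_right, simp)
  then show ?thesis
    using g by (intro that[of g]) auto
qed

text \<open>Choosing \<open>u\<close> inside the kernel of \<open>b\<close> keeps the projection
  within this hyperplane, so vanishing on the smaller space suffices for division along the
  hyperplane.\<close>

lemma divisible_on_hyperplane:
  fixes a b :: "'g::euclidean_space \<Rightarrow>\<^sub>L real"
  assumes u: "b u = 0" "a u = 1" and f: "real_polynomial_function f"
    and van: "\<And>x. b x = 0 \<Longrightarrow> a x = 0 \<Longrightarrow> f x = 0"
  obtains g where "real_polynomial_function g" "\<And>x. b x = 0 \<Longrightarrow> f x = a x * g x"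
proof -
  obtain g where g: "real_polynomial_function g" "\<And>x. f x - f (x - a x *\<^sub>R u) = a x * g x"
    using divisible_along[OF f, of a u] by blast
  have "f (x - a x *\<^sub>R u) = 0" if "b x = 0" for x
    using u that by (intro van) (auto simp: blinfun.diff_right blinfun.scaleR_right)
  then show ?thesis
    using g by (intro that[of g]) (simp_all flip: g(2))
qed

text \<open>The points of \<open>K\<close> off the kernel of \<open>a\<close> are dense in
  \<open>K\<close>: from a point of the kernel, every nonzero step in the direction \<open>w\<close>
  leaves it. Continuity carries the vanishing over.\<close>

lemma cancel_functional_on_subspace:
  fixes a :: "'g::euclidean_space \<Rightarrow>\<^sub>L real"
  assumes K: "subspace K" and w: "w \<in> K" "a w \<noteq> 0"
    and F: "continuous_on UNIV F" and van: "\<And>x. x \<in> K \<Longrightarrow> a x * F x = (0::real)"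
    and x: "x \<in> K"
  shows "F x = 0"
proof (cases "a x = 0")
  case False
  then show ?thesis using van[OF x] by simp
next
  case True
  have "((\<lambda>t. F (x + t *\<^sub>R w)) \<longlongrightarrow> F (x + 0 *\<^sub>R w)) (at 0)"
  proof -
    have "continuous_on UNIV (\<lambda>t. F (x + t *\<^sub>R w))"
      by (rule continuous_on_compose2[OF F]) (intro continuous_intros subset_UNIV)+
    then have "isCont (\<lambda>t. F (x + t *\<^sub>R w)) 0"
      by (simp add: continuous_on_eq_continuous_at)
    then show ?thesis by (simp only: isCont_def)
  qed
  moreover have "eventually (\<lambda>t. F (x + t *\<^sub>R w) = 0) (at 0)"
    unfolding eventually_at_filter
  proof (intro always_eventually allI impI)
    fix t :: real assume t: "t \<noteq> 0"
    have "a (x + t *\<^sub>R w) \<noteq> 0"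
      using t w True by (simp add: blinfun.add_right blinfun.scaleR_right)
    moreover have "x + t *\<^sub>R w \<in> K"
      using K x w by (simp add: subspace_add subspace_scale)
    ultimately show "F (x + t *\<^sub>R w) = 0"
      using van by fastforce
  qed
  then have "((\<lambda>t. F (x + t *\<^sub>R w)) \<longlongrightarrow> 0) (at 0)"
    by (rule tendsto_eventually)
  ultimately show ?thesis
    using tendsto_unique[of "at (0::real)"] by fastforce
qed

lemma continuous_real_polynomial_function:
  "real_polynomial_function (f :: 'g::euclidean_space \<Rightarrow> real) \<Longrightarrow> continuous_on S f"
  by (intro continuous_on_polymonial_function) (simp add: real_polynomial_function_eq)

lemma cancel_prod_on_subspace:
  fixes \<alpha> :: "'e \<Rightarrow> 'g::euclidean_space \<Rightarrow>\<^sub>L real"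
  assumes K: "subspace K" and fin: "finite I" and w: "\<And>i. i \<in> I \<Longrightarrow> \<exists>w\<in>K. \<alpha> i w \<noteq> 0"
    and F: "real_polynomial_function F" and van: "\<And>x. x \<in> K \<Longrightarrow> F x * (\<Prod>i\<in>I. \<alpha> i x) = 0"
    and x: "x \<in> K"
  shows "F x = 0"
  using fin w F van x
proof (induction I arbitrary: F x rule: finite_induct)
  case empty
  then show ?case by simp
next
  case (insert i I)
  have prod: "real_polynomial_function (\<lambda>x. F x * (\<Prod>i\<in>I. \<alpha> i x))"
    using insert.prems insert.hyps by (intro real_polynomial_function.intros(4)) auto
  obtain w where w: "w \<in> K" "\<alpha> i w \<noteq> 0" using insert.prems by blast
  have "F y * (\<Prod>i\<in>I. \<alpha> i y) = 0" if y: "y \<in> K" for y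
  proof (rule cancel_functional_on_subspace[OF K w continuous_real_polynomial_function[OF prod] _ y])
    show "\<alpha> i x * (F x * (\<Prod>i\<in>I. \<alpha> i x)) = 0" if "x \<in> K" for x
      using insert.prems(3)[OF that] insert.hyps by auto
  qed
  then show ?case
    using insert by blast
qed

text \<open>Factors are split off one at a time. The quotient so far still vanishes where both
  \<open>b\<close> and the next form do: \<open>triple\<close> keeps each earlier factor from being
  identically zero there, so the earlier product can be cancelled.\<close>

lemma divisible_by_prod_on_hyperplane:
  fixes \<alpha> :: "'e \<Rightarrow> 'g::euclidean_space \<Rightarrow>\<^sub>L real"
    and b :: "'g \<Rightarrow>\<^sub>L real"
  assumes "finite I"
    and pair: "\<And>i. i \<in> I \<Longrightarrow> \<exists>u. b u = 0 \<and> \<alpha> i u = 1"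
    and triple: "\<And>i j. i \<in> I \<Longrightarrow> j \<in> I \<Longrightarrow> i \<noteq> j \<Longrightarrow> \<exists>w. b w = 0 \<and> \<alpha> i w = 0 \<and> \<alpha> j w \<noteq> 0"
    and f: "real_polynomial_function f"
    and van: "\<And>i x. i \<in> I \<Longrightarrow> b x = 0 \<Longrightarrow> \<alpha> i x = 0 \<Longrightarrow> f x = 0"
  shows "\<exists>g. real_polynomial_function g \<and> (\<forall>x. blinfun_apply b x = 0 \<longrightarrow> f x = g x * (\<Prod>i\<in>I. \<alpha> i x))"
  using assms(1) pair triple van
proof (induction I rule: finite_induct)
  case empty
  then show ?case using f by auto
next
  case (insert i I)
  have "\<exists>g. real_polynomial_function g \<and> (\<forall>x. blinfun_apply b x = 0 \<longrightarrow> f x = g x * (\<Prod>i\<in>I. \<alpha> i x))"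
    by (rule insert.IH; use insert.prems in blast)
  then obtain g where g: "real_polynomial_function g"
    "\<And>x. b x = 0 \<Longrightarrow> f x = g x * (\<Prod>i\<in>I. \<alpha> i x)"
    by blast
  define K where "K = {x. b x = 0 \<and> \<alpha> i x = 0}"
  have K: "subspace K"
    by (auto simp: K_def subspace_def blinfun.add_right blinfun.scaleR_right)
  have "g x = 0" if "b x = 0" "\<alpha> i x = 0" for x
  proof (rule cancel_prod_on_subspace[OF K insert.hyps(1) _ g(1)])
    show "\<exists>w\<in>K. \<alpha> j w \<noteq> 0" if "j \<in> I" for j
      using insert.prems(2)[of i j] that insert.hyps by (auto simp: K_def)
    show "g x * (\<Prod>i\<in>I. \<alpha> i x) = 0" if "x \<in> K" for x
      using that g(2) insert.prems(3)[of i x] by (auto simp: K_def)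
    show "x \<in> K" using that by (simp add: K_def)
  qed
  note van = this
  obtain u where "b u = 0" "\<alpha> i u = 1"
    using insert.prems(1)[of i] by blast
  then obtain h where "real_polynomial_function h" "\<And>x. b x = 0 \<Longrightarrow> g x = \<alpha> i x * h x"
    using divisible_on_hyperplane[OF _ _ g(1) van] by blast
  then show ?case
    using g insert.hyps by (intro exI[of _ h]) auto
qed

text \<open>Newton interpolation with hyperplanes as nodes. The correction for a new hyperplane is a
  multiple of the product of the earlier forms, hence leaves the earlier restrictions intact. By
  \<open>compat\<close> the error on the new hyperplane vanishes on its intersections with the
  earlier ones, which makes it divisible by that product.\<close>

lemma polynomial_interpolation:
  fixes \<alpha> :: "'e \<Rightarrow> 'g::euclidean_space \<Rightarrow>\<^sub>L real"
  assumes "finite I"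
    and pair: "\<And>i j. i \<in> I \<Longrightarrow> j \<in> I \<Longrightarrow> i \<noteq> j \<Longrightarrow> \<exists>u. \<alpha> i u = 0 \<and> \<alpha> j u = 1"
    and triple: "\<And>i j k. i \<in> I \<Longrightarrow> j \<in> I \<Longrightarrow> k \<in> I \<Longrightarrow> i \<noteq> j \<Longrightarrow> i \<noteq> k \<Longrightarrow> j \<noteq> k \<Longrightarrow>
      \<exists>w. \<alpha> i w = 0 \<and> \<alpha> j w = 0 \<and> \<alpha> k w \<noteq> 0"
    and f: "\<And>i. i \<in> I \<Longrightarrow> real_polynomial_function (f i)"
    and compat: "\<And>i j x. i \<in> I \<Longrightarrow> j \<in> I \<Longrightarrow> i \<noteq> j \<Longrightarrow> \<alpha> i x = 0 \<Longrightarrow> \<alpha> j x = 0 \<Longrightarrow> f i x = f j x"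
  shows "\<exists>g. real_polynomial_function g \<and> (\<forall>i\<in>I. \<forall>x. blinfun_apply (\<alpha> i) x = 0 \<longrightarrow> g x = f i x)"
  using assms
proof (induction I rule: finite_induct)
  case empty
  then show ?case by auto
next
  case (insert j I)
  have "\<exists>g. real_polynomial_function g \<and> (\<forall>i\<in>I. \<forall>x. blinfun_apply (\<alpha> i) x = 0 \<longrightarrow> g x = f i x)"
  proof (rule insert.IH)
    show "\<exists>u. \<alpha> i u = 0 \<and> \<alpha> k u = 1" if "i \<in> I" "k \<in> I" "i \<noteq> k" for i k
      using insert.prems(1)[of i k] that by simp
    show "\<exists>w. \<alpha> i w = 0 \<and> \<alpha> k w = 0 \<and> \<alpha> l w \<noteq> 0"
      if "i \<in> I" "k \<in> I" "l \<in> I" "i \<noteq> k" "i \<noteq> l" "k \<noteq> l" for i k l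
      using insert.prems(2)[of i k l] that by simp
    show "real_polynomial_function (f i)" if "i \<in> I" for i
      using insert.prems(3)[of i] that by simp
    show "f i x = f k x" if "i \<in> I" "k \<in> I" "i \<noteq> k" "\<alpha> i x = 0" "\<alpha> k x = 0" for i k x
      using insert.prems(4)[of i k x] that by simp
  qed
  then obtain g where g: "real_polynomial_function g"
    "\<And>i x. i \<in> I \<Longrightarrow> \<alpha> i x = 0 \<Longrightarrow> g x = f i x"
    by blast
  have "\<exists>h. real_polynomial_function h \<and>
      (\<forall>x. blinfun_apply (\<alpha> j) x = 0 \<longrightarrow> f j x - g x = h x * (\<Prod>i\<in>I. \<alpha> i x))"
  proof (rule divisible_by_prod_on_hyperplane[OF insert.hyps(1)])
    show "\<exists>u. \<alpha> j u = 0 \<and> \<alpha> i u = 1" if "i \<in> I" for i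
      using that insert.prems(1) insert.hyps(2) by blast
    show "\<exists>w. \<alpha> j w = 0 \<and> \<alpha> i w = 0 \<and> \<alpha> k w \<noteq> 0" if "i \<in> I" "k \<in> I" "i \<noteq> k" for i k
      using that insert.prems(2)[of j i k] insert.hyps(2) by blast
    show "real_polynomial_function (\<lambda>x. f j x - g x)"
      using insert.prems(3) g(1) by blast
    show "f j x - g x = 0" if "i \<in> I" "\<alpha> j x = 0" "\<alpha> i x = 0" for i x
    proof -
      have "i \<noteq> j" using that insert.hyps(2) by auto
      then show ?thesis using that g(2)[of i x] insert.prems(4)[of i j x] by simp
    qed
  qed
  then obtain h where h: "real_polynomial_function h"
    "\<And>x. \<alpha> j x = 0 \<Longrightarrow> f j x - g x = h x * (\<Prod>i\<in>I. \<alpha> i x)"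
    by blast
  define G where "G x = g x + h x * (\<Prod>i\<in>I. \<alpha> i x)" for x
  have "real_polynomial_function G"
    unfolding G_def using g(1) h(1) insert.hyps(1) by (intro real_polynomial_function.intros(3,4)) auto
  moreover have "G x = f i x" if "i \<in> insert j I" "\<alpha> i x = 0" for i x
  proof (cases "i = j")
    case True
    then show ?thesis using h(2)[of x] that by (simp add: G_def)
  next
    case False
    then have "i \<in> I" using that by simp
    then have "(\<Prod>i\<in>I. \<alpha> i x) = 0"
      using that insert.hyps(1) by (metis prod_zero)
    then show ?thesis using g(2) that \<open>i \<in> I\<close> by (simp add: G_def)
  qed
  ultimately show ?case by blast
qed

section \<open>Homogeneous components and homogeneous interpolation\<close>

lemma sym_powI:
  assumes "real_polynomial_function f" "\<And>c x. f (c *\<^sub>R x) = c ^ m * f x"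
  shows "f \<in> sym_pow m"
  using assms by (simp add: sym_pow_def sym_alg_def)

lemma sym_powD:
  assumes "f \<in> sym_pow m"
  shows "real_polynomial_function f" "f (c *\<^sub>R x) = c ^ m * f x"
  using assms by (auto simp: sym_pow_def sym_alg_def)

text \<open>The coefficient of degree \<open>m\<close> in \<open>P x\<close>, as a function of
  \<open>x\<close>, is the homogeneous component of \<open>f\<close> of that degree. Storing the
  components as coefficients turns products of functions into products of univariate
  polynomials.\<close>

lemma homogeneous_components:
  fixes f :: "'g::euclidean_space \<Rightarrow> real"
  assumes "real_polynomial_function f"
  shows "\<exists>P. (\<forall>m. (\<lambda>x. coeff (P x) m) \<in> sym_pow m) \<and> (\<forall>c x. f (c *\<^sub>R x) = poly (P x) c)"
  using assms
proof (induction f rule: real_polynomial_function.induct)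
  case (linear f)
  have "(\<lambda>x. coeff [:0, f x:] m) \<in> sym_pow m" for m
  proof (cases "m = 1")
    case True
    then show ?thesis
      using linear by (intro sym_powI) (auto simp: linear_simps)
  next
    case False
    then have "coeff [:0, f x:] m = 0" for x
      by (simp add: coeff_pCons split: nat.splits)
    then show ?thesis
      by (intro sym_powI) auto
  qed
  then show ?case
    using linear by (intro exI[of _ "\<lambda>x. [:0, f x:]"]) (auto simp: linear_simps)
next
  case (const c)
  show ?case
    by (intro exI[of _ "\<lambda>x. [:c:]"]) (auto intro!: sym_powI simp: coeff_pCons split: nat.splits)
next
  case (add f g)
  from add.IH(1) obtain P where P: "\<And>m. (\<lambda>x. coeff (P x) m) \<in> sym_pow m"
    "\<And>c x. f (c *\<^sub>R x) = poly (P x) c" by blast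
  from add.IH(2) obtain Q where Q: "\<And>m. (\<lambda>x. coeff (Q x) m) \<in> sym_pow m"
    "\<And>c x. g (c *\<^sub>R x) = poly (Q x) c" by blast
  have "(\<lambda>x. coeff (P x + Q x) m) \<in> sym_pow m" for m
  proof (rule sym_powI)
    show "real_polynomial_function (\<lambda>x. coeff (P x + Q x) m)"
      unfolding coeff_add
      by (rule real_polynomial_function.intros(3)[OF sym_powD(1)[OF P(1)] sym_powD(1)[OF Q(1)]])
    show "coeff (P (c *\<^sub>R x) + Q (c *\<^sub>R x)) m = c ^ m * coeff (P x + Q x) m" for c x
      by (simp only: coeff_add sym_powD(2)[OF P(1)] sym_powD(2)[OF Q(1)] distrib_left)
  qed
  then show ?case
    using P Q by (intro exI[of _ "\<lambda>x. P x + Q x"]) simp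
next
  case (mult f g)
  from mult.IH(1) obtain P where P: "\<And>m. (\<lambda>x. coeff (P x) m) \<in> sym_pow m"
    "\<And>c x. f (c *\<^sub>R x) = poly (P x) c" by blast
  from mult.IH(2) obtain Q where Q: "\<And>m. (\<lambda>x. coeff (Q x) m) \<in> sym_pow m"
    "\<And>c x. g (c *\<^sub>R x) = poly (Q x) c" by blast
  have "(\<lambda>x. coeff (P x * Q x) m) \<in> sym_pow m" for m
  proof (rule sym_powI)
    show "real_polynomial_function (\<lambda>x. coeff (P x * Q x) m)"
      unfolding coeff_mult
      by (intro real_polynomial_function_sum real_polynomial_function.intros(4) finite_atMost
          sym_powD(1)[OF P(1)] sym_powD(1)[OF Q(1)])
    fix c x
    show "coeff (P (c *\<^sub>R x) * Q (c *\<^sub>R x)) m = c ^ m * coeff (P x * Q x) m"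
      unfolding coeff_mult sum_distrib_left
    proof (rule sum.cong)
      fix i assume "i \<in> {..m}"
      then have "c ^ m = c ^ i * c ^ (m - i)" by (simp flip: power_add)
      then show "coeff (P (c *\<^sub>R x)) i * coeff (Q (c *\<^sub>R x)) (m - i)
          = c ^ m * (coeff (P x) i * coeff (Q x) (m - i))"
        by (simp only: sym_powD(2)[OF P(1)] sym_powD(2)[OF Q(1)] mult_ac)
    qed simp
  qed
  then show ?case
    using P Q by (intro exI[of _ "\<lambda>x. P x * Q x"]) simp
qed

text \<open>Kernels are closed under scaling, so on the kernel of \<open>\<alpha> i\<close> an
  interpolant \<open>g\<close> satisfies \<open>g (c *\<^sub>R x) = c ^ m * f i x\<close> for all
  \<open>c\<close>. Comparing coefficients in \<open>c\<close> shows that its component of degree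
  \<open>m\<close> interpolates by itself.\<close>

lemma homogeneous_interpolation:
  fixes \<alpha> :: "'e \<Rightarrow> 'g::euclidean_space \<Rightarrow>\<^sub>L real"
  assumes "finite I"
    and pair: "\<And>i j. i \<in> I \<Longrightarrow> j \<in> I \<Longrightarrow> i \<noteq> j \<Longrightarrow> \<exists>u. \<alpha> i u = 0 \<and> \<alpha> j u = 1"
    and triple: "\<And>i j k. i \<in> I \<Longrightarrow> j \<in> I \<Longrightarrow> k \<in> I \<Longrightarrow> i \<noteq> j \<Longrightarrow> i \<noteq> k \<Longrightarrow> j \<noteq> k \<Longrightarrow>
      \<exists>w. \<alpha> i w = 0 \<and> \<alpha> j w = 0 \<and> \<alpha> k w \<noteq> 0"
    and f: "\<And>i. i \<in> I \<Longrightarrow> f i \<in> sym_pow m"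
    and compat: "\<And>i j x. i \<in> I \<Longrightarrow> j \<in> I \<Longrightarrow> i \<noteq> j \<Longrightarrow> \<alpha> i x = 0 \<Longrightarrow> \<alpha> j x = 0 \<Longrightarrow> f i x = f j x"
  obtains g where "g \<in> sym_pow m" "\<And>i x. i \<in> I \<Longrightarrow> \<alpha> i x = 0 \<Longrightarrow> g x = f i x"
proof -
  have "\<exists>g. real_polynomial_function g \<and> (\<forall>i\<in>I. \<forall>x. blinfun_apply (\<alpha> i) x = 0 \<longrightarrow> g x = f i x)"
    using assms sym_powD(1) by (intro polynomial_interpolation) blast+
  then obtain g where g: "real_polynomial_function g" "\<And>i x. i \<in> I \<Longrightarrow> \<alpha> i x = 0 \<Longrightarrow> g x = f i x"
    by blast
  obtain P where P: "\<And>m. (\<lambda>x. coeff (P x) m) \<in> sym_pow m" "\<And>c x. g (c *\<^sub>R x) = poly (P x) c"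
    using homogeneous_components[OF g(1)] by blast
  have "coeff (P x) m = f i x" if "i \<in> I" "\<alpha> i x = 0" for i x
  proof -
    have "poly (P x) c = poly (monom (f i x) m) c" for c
      using g(2)[OF that(1), of "c *\<^sub>R x"] that sym_powD(2)[OF f[OF that(1)], of c x] P(2)[of c x]
      by (simp add: blinfun.scaleR_right poly_monom)
    then have "P x = monom (f i x) m"
      by (simp flip: poly_eq_poly_eq_iff add: fun_eq_iff)
    then show ?thesis by simp
  qed
  then show ?thesis
    using P(1) that by blast
qed

section \<open>The zeroth Betti number of a two-dimensional face\<close>

text \<open>Summed over a component, this counts its vertices of index 0. The factor \<open>1/2\<close> for an edge
  whose axial vector vanishes at \<open>x\<close> keeps the count constant across the walls.\<close>

definition cone_weight ::
    "('v, 'e) pre_digraph \<Rightarrow> ('e \<Rightarrow> 'g::euclidean_space \<Rightarrow>\<^sub>L real) \<Rightarrow> 'v \<Rightarrow> 'g \<Rightarrow> real" where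
  "cone_weight \<Gamma> \<alpha> v x = (\<Prod>e\<in>out_arcs \<Gamma> v. (1 + sgn (\<alpha> e x)) / 2)"

lemma out_arcs_annihilated:
  "out_arcs (annihilated \<Gamma> \<alpha> H) v = {e \<in> out_arcs \<Gamma> v. \<forall>x\<in>H. \<alpha> e x = 0}"
  by (auto simp: out_arcs_def annihilated_def)

lemma annihilated_simps [simp]:
  "verts (annihilated \<Gamma> \<alpha> H) = verts \<Gamma>" "tail (annihilated \<Gamma> \<alpha> H) = tail \<Gamma>"
  "head (annihilated \<Gamma> \<alpha> H) = head \<Gamma>"
  "arcs (annihilated \<Gamma> \<alpha> H) = {e \<in> arcs \<Gamma>. \<forall>x\<in>H. \<alpha> e x = 0}"
  by (auto simp: annihilated_def)

lemma ascending_simps [simp]: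
  "verts (ascending \<Gamma> \<alpha> \<xi>) = verts \<Gamma>" "tail (ascending \<Gamma> \<alpha> \<xi>) = tail \<Gamma>"
  "head (ascending \<Gamma> \<alpha> \<xi>) = head \<Gamma>"
  "arcs (ascending \<Gamma> \<alpha> \<xi>) = {e \<in> arcs \<Gamma>. \<alpha> e \<xi> > 0}"
  by (auto simp: ascending_def)

text \<open>Of two common kernels of codimension 2 one contains the other, so they coincide by
  dimension. Hence at a point off such a kernel at most one of the annihilated edges at a vertex can
  vanish.\<close>

lemma not_both_zero_off_common_kernel:
  fixes a b f g :: "'g::euclidean_space \<Rightarrow>\<^sub>L real"
  assumes ab: "\<And>c. a \<noteq> c *\<^sub>R b" "\<And>c. b \<noteq> c *\<^sub>R a"
    and fg: "\<And>c. f \<noteq> c *\<^sub>R g" "\<And>c. g \<noteq> c *\<^sub>R f"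
    and van: "\<And>x. a x = 0 \<Longrightarrow> b x = 0 \<Longrightarrow> f x = 0 \<and> g x = 0"
    and x: "f x = 0" "g x = 0"
  shows "a x = 0 \<and> b x = 0"
proof -
  obtain u v where uv: "a u = 1" "b u = 0" "a v = 0" "b v = 1"
    by (rule exists_dual_basis[OF ab])
  obtain u' v' where uv': "f u' = 1" "g u' = 0" "f v' = 0" "g v' = 1"
    by (rule exists_dual_basis[OF fg])
  have "{x. a x = 0 \<and> b x = 0} = {x. f x = 0 \<and> g x = 0}"
    using van dim_common_kernel[OF uv] dim_common_kernel[OF uv']
    by (intro subspace_dim_equal) auto
  then show ?thesis using x by blast
qed

context one_skeleton
begin

section \<open>Axial vectors under reversal and under the connection\<close>

lemma axial_arev:
  assumes "e \<in> arcs \<Gamma>"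
  obtains k where "k > 0" "\<alpha> (arev e) = - (k *\<^sub>R \<alpha> e)"
proof -
  obtain m m' where "m > 0" "m' > 0" and eq: "m' *\<^sub>R \<alpha> (arev e) = - (m *\<^sub>R \<alpha> e)"
    using A2[OF assms] by blast
  have "\<alpha> (arev e) = (1 / m') *\<^sub>R (m' *\<^sub>R \<alpha> (arev e))"
    using \<open>m' > 0\<close> by simp
  also have "\<dots> = - ((m / m') *\<^sub>R \<alpha> e)"
    by (simp add: eq)
  finally show ?thesis
    using \<open>m > 0\<close> \<open>m' > 0\<close> by (intro that[of "m / m'"]) auto
qed

lemma sgn_axial_arev:
  assumes "e \<in> arcs \<Gamma>"
  shows "sgn (\<alpha> (arev e) x) = - sgn (\<alpha> e x)"
proof -
  obtain k where "k > 0" "\<alpha> (arev e) = - (k *\<^sub>R \<alpha> e)"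
    by (rule axial_arev[OF assms])
  then show ?thesis
    by (simp add: uminus_blinfun.rep_eq scaleR_blinfun.rep_eq sgn_mult)
qed

lemma axial_arev_eq_0_iff: "e \<in> arcs \<Gamma> \<Longrightarrow> \<alpha> (arev e) x = 0 \<longleftrightarrow> \<alpha> e x = 0"
  by (metis sgn_axial_arev sgn_0_0 neg_equal_0_iff_equal)

lemma axial_arev_pos_iff: "e \<in> arcs \<Gamma> \<Longrightarrow> \<alpha> (arev e) x > 0 \<longleftrightarrow> \<alpha> e x < 0"
  by (metis sgn_axial_arev sgn_greater sgn_less neg_0_less_iff_less)

text \<open>A3 makes \<open>\<alpha> (\<theta> e e)\<close> a multiple of \<open>\<alpha> e\<close>,
  hence of \<open>\<alpha> (arev e)\<close>, and by A1 distinct edges at the head of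
  \<open>e\<close> are never proportional.\<close>

lemma connection_self:
  assumes e: "e \<in> arcs \<Gamma>"
  shows "\<theta> e e = arev e"
proof (rule ccontr)
  assume "\<theta> e e \<noteq> arev e"
  moreover have "\<theta> e e \<in> out_arcs \<Gamma> (head \<Gamma> e)"
    using bij_betwE[OF connection_bij[OF e]] e by simp
  moreover have "arev e \<in> out_arcs \<Gamma> (head \<Gamma> e)"
    using e by simp
  ultimately have indep: "\<alpha> (\<theta> e e) \<noteq> c *\<^sub>R \<alpha> (arev e)" for c
    using e by (intro indep_on_pairD A1) auto
  obtain k where k: "k > 0" "\<alpha> (arev e) = - (k *\<^sub>R \<alpha> e)"
    by (rule axial_arev[OF e])
  obtain l c where "\<alpha> (\<theta> e e) = l *\<^sub>R \<alpha> e + c *\<^sub>R \<alpha> e"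
    using A3[OF e, of e] e by auto
  then obtain s where "\<alpha> (\<theta> e e) = s *\<^sub>R \<alpha> e"
    by (metis scaleR_left_distrib)
  then have "\<alpha> (\<theta> e e) = (- (s / k)) *\<^sub>R \<alpha> (arev e)"
    using k by simp
  then show False
    using indep by blast
qed

text \<open>On \<open>H\<close> the term with \<open>\<alpha> e\<close> drops out of A3 and a
  nonzero rescaling remains, so an edge is annihilated exactly when its transport is. The face thus
  inherits the connection.\<close>

lemma connection_bij_annihilated:
  assumes "e \<in> out_arcs (annihilated \<Gamma> \<alpha> H) v"
  shows "bij_betw (\<theta> e) (out_arcs (annihilated \<Gamma> \<alpha> H) v)
    (out_arcs (annihilated \<Gamma> \<alpha> H) (head \<Gamma> e))"
proof -
  have e: "e \<in> arcs \<Gamma>" "tail \<Gamma> e = v" and van: "\<And>x. x \<in> H \<Longrightarrow> \<alpha> e x = 0"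
    using assms by (auto simp: out_arcs_annihilated)
  have bij: "bij_betw (\<theta> e) (out_arcs \<Gamma> v) (out_arcs \<Gamma> (head \<Gamma> e))"
    using connection_bij[OF e(1)] e(2) by simp
  have iff: "(\<forall>x\<in>H. \<alpha> (\<theta> e e') x = 0) \<longleftrightarrow> (\<forall>x\<in>H. \<alpha> e' x = 0)"
    if e': "e' \<in> out_arcs \<Gamma> v" for e'
  proof -
    obtain l c where "l > 0" "\<alpha> (\<theta> e e') = l *\<^sub>R \<alpha> e' + c *\<^sub>R \<alpha> e"
      using A3[OF e(1), of e'] e(2) e' by auto
    then show ?thesis
      using van by (simp add: plus_blinfun.rep_eq scaleR_blinfun.rep_eq)
  qed
  have "\<theta> e ` {e' \<in> out_arcs \<Gamma> v. \<forall>x\<in>H. \<alpha> e' x = 0}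
      = {e' \<in> \<theta> e ` out_arcs \<Gamma> v. \<forall>x\<in>H. \<alpha> e' x = 0}"
    using iff by blast
  also have "\<theta> e ` out_arcs \<Gamma> v = out_arcs \<Gamma> (head \<Gamma> e)"
    using bij by (rule bij_betw_imp_surj_on)
  finally show ?thesis
    unfolding out_arcs_annihilated
    using bij by (auto simp: bij_betw_def intro: inj_on_subset)
qed

lemma finite_out_arcs_annihilated [simp]: "finite (out_arcs (annihilated \<Gamma> \<alpha> H) v)"
  by (simp add: out_arcs_annihilated)

text \<open>By reversal the edge \<open>e\<close> contributes complementary factors, of sum 1, at
  its two endpoints. At \<open>x\<^sub>0\<close> the term with \<open>\<alpha> e\<close> drops out
  of A3, so the connection matches the other edges with equal signs, and \<open>near\<close> carries
  these signs over to \<open>x\<close>.\<close>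

lemma cone_weight_across_wall:
  fixes H :: "'g set"
  defines "A \<equiv> annihilated \<Gamma> \<alpha> H"
  assumes e: "e \<in> out_arcs A v" and zero: "\<alpha> e x\<^sub>0 = 0"
    and only: "\<And>e'. e' \<in> out_arcs A v \<Longrightarrow> e' \<noteq> e \<Longrightarrow> \<alpha> e' x\<^sub>0 \<noteq> 0"
    and near: "\<And>e'. e' \<in> arcs \<Gamma> \<Longrightarrow> \<alpha> e' x\<^sub>0 \<noteq> 0 \<Longrightarrow> sgn (\<alpha> e' x) = sgn (\<alpha> e' x\<^sub>0)"
  shows "cone_weight A \<alpha> v x + cone_weight A \<alpha> (head \<Gamma> e) x
    = (\<Prod>e'\<in>out_arcs A v - {e}. (1 + sgn (\<alpha> e' x\<^sub>0)) / 2)" (is "_ = ?P")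
proof -
  have e': "e \<in> arcs \<Gamma>" "tail \<Gamma> e = v"
    using e by (auto simp: A_def out_arcs_annihilated)
  have fin: "finite (out_arcs A v)"
    by (simp add: A_def)
  have "(\<Prod>e'\<in>out_arcs A v - {e}. (1 + sgn (\<alpha> e' x)) / 2) = ?P"
    using only near by (intro prod.cong) (auto simp: A_def out_arcs_annihilated)
  then have 1: "cone_weight A \<alpha> v x = (1 + sgn (\<alpha> e x)) / 2 * ?P"
    unfolding cone_weight_def by (subst prod.remove[OF fin e]) simp
  have sgn: "sgn (\<alpha> (\<theta> e f) x) = sgn (\<alpha> f x\<^sub>0)" if f: "f \<in> out_arcs A v" "f \<noteq> e" for f
  proof -
    have f': "f \<in> out_arcs \<Gamma> (tail \<Gamma> e)"
      using f e' by (auto simp: A_def out_arcs_annihilated)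
    obtain l c where "l > 0" "\<alpha> (\<theta> e f) = l *\<^sub>R \<alpha> f + c *\<^sub>R \<alpha> e"
      using A3[OF e'(1) f'] by blast
    then have "sgn (\<alpha> (\<theta> e f) x\<^sub>0) = sgn (\<alpha> f x\<^sub>0)"
      using zero by (simp add: plus_blinfun.rep_eq scaleR_blinfun.rep_eq sgn_mult)
    moreover have "\<theta> e f \<in> arcs \<Gamma>"
      using bij_betwE[OF connection_bij[OF e'(1)]] f' by auto
    ultimately show ?thesis
      using near[of "\<theta> e f"] only[OF f] by (metis sgn_0_0)
  qed
  \<comment> \<open>Reindexing by the connection allows comparison with the product at
    \<open>v\<close> factor by factor; the factor for \<open>e\<close> becomes the one for
    \<open>arev e\<close>.\<close>
  have "cone_weight A \<alpha> (head \<Gamma> e) x = (\<Prod>f\<in>out_arcs A v. (1 + sgn (\<alpha> (\<theta> e f) x)) / 2)"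
    unfolding cone_weight_def A_def
    by (rule prod.reindex_bij_betw[OF connection_bij_annihilated, symmetric]) (use e in \<open>simp add: A_def\<close>)
  also have "\<dots> = (1 + sgn (\<alpha> (\<theta> e e) x)) / 2
      * (\<Prod>f\<in>out_arcs A v - {e}. (1 + sgn (\<alpha> (\<theta> e f) x)) / 2)"
    by (rule prod.remove[OF fin e])
  also have "(\<Prod>f\<in>out_arcs A v - {e}. (1 + sgn (\<alpha> (\<theta> e f) x)) / 2) = ?P"
    using sgn by (intro prod.cong) auto
  finally have 2: "cone_weight A \<alpha> (head \<Gamma> e) x = (1 - sgn (\<alpha> e x)) / 2 * ?P"
    by (simp add: connection_self[OF e'(1)] sgn_axial_arev[OF e'(1)])
  show ?thesis
    unfolding 1 2 by (simp add: field_simps)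
qed

text \<open>Vertices with a vanishing edge are matched by the involution \<open>\<sigma>\<close>
  that crosses this edge, and each matched pair has constant total weight. At all other vertices
  every sign, hence the weight, is unchanged.\<close>

lemma sum_cone_weight_near:
  fixes H :: "'g set"
  defines "A \<equiv> annihilated \<Gamma> \<alpha> H"
  assumes C: "C \<subseteq> verts \<Gamma>" "\<And>v e. v \<in> C \<Longrightarrow> e \<in> out_arcs A v \<Longrightarrow> head \<Gamma> e \<in> C"
    and only: "\<And>v e e'. v \<in> C \<Longrightarrow> e \<in> out_arcs A v \<Longrightarrow> e' \<in> out_arcs A v \<Longrightarrow> e' \<noteq> e \<Longrightarrow>
      \<alpha> e x\<^sub>0 = 0 \<Longrightarrow> \<alpha> e' x\<^sub>0 \<noteq> 0"
    and near: "\<And>e'. e' \<in> arcs \<Gamma> \<Longrightarrow> \<alpha> e' x\<^sub>0 \<noteq> 0 \<Longrightarrow> sgn (\<alpha> e' x) = sgn (\<alpha> e' x\<^sub>0)"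
  shows "(\<Sum>v\<in>C. cone_weight A \<alpha> v x) = (\<Sum>v\<in>C. cone_weight A \<alpha> v x\<^sub>0)"
proof -
  let ?w = "cone_weight A \<alpha>"
  define W where "W = {v \<in> C. \<exists>e\<in>out_arcs A v. \<alpha> e x\<^sub>0 = 0}"
  have "\<forall>v\<in>W. \<exists>e. e \<in> out_arcs A v \<and> \<alpha> e x\<^sub>0 = 0"
    by (auto simp: W_def)
  then obtain wall where wall: "\<And>v. v \<in> W \<Longrightarrow> wall v \<in> out_arcs A v"
    "\<And>v. v \<in> W \<Longrightarrow> \<alpha> (wall v) x\<^sub>0 = 0"
    by metis
  define \<sigma> where "\<sigma> v = head \<Gamma> (wall v)" for v
  have \<sigma>: "\<sigma> v \<in> W \<and> \<sigma> (\<sigma> v) = v" if v: "v \<in> W" for v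
  proof -
    have e: "wall v \<in> arcs \<Gamma>" "tail \<Gamma> (wall v) = v"
      using wall(1)[OF v] by (auto simp: A_def out_arcs_annihilated)
    have "\<sigma> v \<in> C"
      using C(2) wall(1)[OF v] v by (auto simp: \<sigma>_def W_def)
    have arev: "arev (wall v) \<in> out_arcs A (\<sigma> v)" "\<alpha> (arev (wall v)) x\<^sub>0 = 0"
      using wall[OF v] e axial_arev_eq_0_iff[OF e(1)]
      by (auto simp: A_def out_arcs_annihilated \<sigma>_def)
    then have W: "\<sigma> v \<in> W"
      using \<open>\<sigma> v \<in> C\<close> by (auto simp: W_def)
    \<comment> \<open>The reversed edge vanishes too, and \<open>only\<close> leaves room for a
      single vanishing edge at \<open>\<sigma> v\<close>. This makes \<open>\<sigma>\<close> an
      involution.\<close>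
    have "wall (\<sigma> v) = arev (wall v)"
      using only[OF \<open>\<sigma> v \<in> C\<close> arev(1) wall(1)[OF W]] arev(2) wall(2)[OF W] by blast
    then have "\<sigma> (\<sigma> v) = v"
      using e by (simp add: \<sigma>_def[of "\<sigma> v"])
    then show ?thesis using W by simp
  qed
  \<comment> \<open>Admitting both points as \<open>y\<close> equates their pair sums, since the
    right-hand side depends on \<open>x\<^sub>0\<close> alone.\<close>
  have pair: "?w v y + ?w (\<sigma> v) y = (\<Prod>e'\<in>out_arcs A v - {wall v}. (1 + sgn (\<alpha> e' x\<^sub>0)) / 2)"
    if v: "v \<in> W" and y: "y = x \<or> y = x\<^sub>0" for v y
    unfolding \<sigma>_def A_def
  proof (rule cone_weight_across_wall)
    show "wall v \<in> out_arcs (annihilated \<Gamma> \<alpha> H) v" "\<alpha> (wall v) x\<^sub>0 = 0"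
      using wall[OF v] by (auto simp: A_def)
    show "\<alpha> e' x\<^sub>0 \<noteq> 0" if "e' \<in> out_arcs (annihilated \<Gamma> \<alpha> H) v" "e' \<noteq> wall v" for e'
      using only[of v "wall v" e'] wall[OF v] that v by (auto simp: A_def W_def)
    show "sgn (\<alpha> e' y) = sgn (\<alpha> e' x\<^sub>0)" if "e' \<in> arcs \<Gamma>" "\<alpha> e' x\<^sub>0 \<noteq> 0" for e'
      using y near[OF that] by auto
  qed
  \<comment> \<open>Summing over all of \<open>W\<close> counts each weight twice, which spares
    choosing a representative of each pair.\<close>
  have "2 * (\<Sum>v\<in>W. ?w v y) = (\<Sum>v\<in>W. ?w v y + ?w (\<sigma> v) y)" for y
  proof -
    have "(\<Sum>v\<in>W. ?w (\<sigma> v) y) = (\<Sum>v\<in>W. ?w v y)"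
      using \<sigma> by (intro sum.reindex_bij_witness[of W \<sigma> \<sigma>]) auto
    then show ?thesis by (simp add: sum.distrib)
  qed
  moreover have "(\<Sum>v\<in>W. ?w v x + ?w (\<sigma> v) x) = (\<Sum>v\<in>W. ?w v x\<^sub>0 + ?w (\<sigma> v) x\<^sub>0)"
    using pair by (intro sum.cong) auto
  ultimately have on: "(\<Sum>v\<in>W. ?w v x) = (\<Sum>v\<in>W. ?w v x\<^sub>0)"
    by (metis mult_cancel_left zero_neq_numeral)
  have off: "(\<Sum>v\<in>C - W. ?w v x) = (\<Sum>v\<in>C - W. ?w v x\<^sub>0)"
    unfolding cone_weight_def
    using near by (intro sum.cong prod.cong refl) (auto simp: W_def A_def out_arcs_annihilated)
  have "finite C"
    using C(1) finite_verts finite_subset by blast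
  moreover have "W \<subseteq> C"
    by (auto simp: W_def)
  ultimately show ?thesis
    using on off by (simp add: sum.subset_diff[of W C])
qed

text \<open>The total is locally constant on the complement of \<open>H\<close>, where at most one
  annihilated edge per vertex vanishes at a time, and this complement is connected.\<close>

lemma sum_cone_weight_constant:
  fixes a b :: "'g \<Rightarrow>\<^sub>L real"
  assumes ab: "\<And>c. a \<noteq> c *\<^sub>R b" "\<And>c. b \<noteq> c *\<^sub>R a"
  defines "H \<equiv> {x. a x = 0 \<and> b x = 0}"
  defines "A \<equiv> annihilated \<Gamma> \<alpha> H"
  assumes C: "C \<subseteq> verts \<Gamma>" "\<And>v e. v \<in> C \<Longrightarrow> e \<in> out_arcs A v \<Longrightarrow> head \<Gamma> e \<in> C"
    and x: "x \<notin> H" and y: "y \<notin> H"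
  shows "(\<Sum>v\<in>C. cone_weight A \<alpha> v x) = (\<Sum>v\<in>C. cone_weight A \<alpha> v y)"
proof -
  let ?M = "\<lambda>x. \<Sum>v\<in>C. cone_weight A \<alpha> v x"
  obtain u v where uv: "a u = 1" "b u = 0" "a v = 0" "b v = 1"
    by (rule exists_dual_basis[OF ab])
  have conn: "Topological_Spaces.connected (- H)"
    using connected_complement_common_kernel[OF uv] by (simp only: H_def Collect_neg_eq)
  have "?M constant_on (- H)"
  proof (rule locally_constant_imp_constant[OF conn])
    fix x\<^sub>0 assume x\<^sub>0: "x\<^sub>0 \<in> - H"
    \<comment> \<open>The neighbourhood of \<open>x\<^sub>0\<close> on which no edge that is nonzero
      at \<open>x\<^sub>0\<close> changes sign.\<close>
    define T where "T = (\<Inter>e\<in>{e \<in> arcs \<Gamma>. \<alpha> e x\<^sub>0 \<noteq> 0}. {x. 0 < \<alpha> e x * \<alpha> e x\<^sub>0})"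
    have "open T"
      unfolding T_def by (intro open_INT ballI open_Collect_less continuous_intros) auto
    then have "openin (top_of_set (- H)) (- H \<inter> T)"
      by (rule openin_open_Int)
    moreover have "x\<^sub>0 \<in> T"
      by (auto simp: T_def zero_less_mult_iff)
    moreover have "?M x = ?M x\<^sub>0" if "x \<in> T" for x
      unfolding A_def
    proof (rule sum_cone_weight_near[OF C(1)])
      show "head \<Gamma> e \<in> C" if "v \<in> C" "e \<in> out_arcs (annihilated \<Gamma> \<alpha> H) v" for v e
        using C(2) that by (simp add: A_def)
      show "\<alpha> e' x\<^sub>0 \<noteq> 0" if "v \<in> C" "e \<in> out_arcs (annihilated \<Gamma> \<alpha> H) v"
        "e' \<in> out_arcs (annihilated \<Gamma> \<alpha> H) v" "e' \<noteq> e" "\<alpha> e x\<^sub>0 = 0" for v e e'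
      proof
        assume 0: "\<alpha> e' x\<^sub>0 = 0"
        have e: "e \<in> out_arcs \<Gamma> v" "e' \<in> out_arcs \<Gamma> v"
          "\<And>x. x \<in> H \<Longrightarrow> \<alpha> e x = 0 \<and> \<alpha> e' x = 0"
          using that by (auto simp: out_arcs_annihilated)
        have v: "v \<in> verts \<Gamma>"
          using C(1) that(1) by blast
        have "a x\<^sub>0 = 0 \<and> b x\<^sub>0 = 0"
        proof (rule not_both_zero_off_common_kernel[OF ab])
          show "\<alpha> e \<noteq> c *\<^sub>R \<alpha> e'" "\<alpha> e' \<noteq> c *\<^sub>R \<alpha> e" for c
            using A1[OF v e(1,2)] A1[OF v e(2,1)] that(4) by (auto dest!: indep_on_pairD)
          show "\<alpha> e x = 0 \<and> \<alpha> e' x = 0" if "a x = 0" "b x = 0" for x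
            using e(3) that by (simp add: H_def)
        qed (use that 0 in auto)
        then show False
          using x\<^sub>0 by (simp add: H_def)
      qed
      show "sgn (\<alpha> e' x) = sgn (\<alpha> e' x\<^sub>0)" if "e' \<in> arcs \<Gamma>" "\<alpha> e' x\<^sub>0 \<noteq> 0" for e'
      proof -
        have "0 < \<alpha> e' x * \<alpha> e' x\<^sub>0"
          using \<open>x \<in> T\<close> that by (auto simp: T_def)
        then show ?thesis
          by (auto simp: zero_less_mult_iff)
      qed
    qed
    ultimately show "\<exists>T. openin (top_of_set (- H)) T \<and> x\<^sub>0 \<in> T \<and> (\<forall>x\<in>T. ?M x = ?M x\<^sub>0)"
      using x\<^sub>0 by blast
  qed
  then obtain k where "\<And>x. x \<in> - H \<Longrightarrow> ?M x = k"
    unfolding constant_on_def by blast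
  from this[of x] this[of y] show ?thesis
    using x y by simp
qed

section \<open>Counting the local minima of a component\<close>

lemma cone_weight_polarized:
  assumes "finite (out_arcs A v)" "\<And>e. e \<in> out_arcs A v \<Longrightarrow> \<alpha> e \<xi> \<noteq> 0"
  shows "cone_weight A \<alpha> v \<xi> = of_bool (descending A \<alpha> \<xi> v = {})"
proof (cases "descending A \<alpha> \<xi> v = {}")
  case True
  then have "(1 + sgn (\<alpha> e \<xi>)) / 2 = 1" if "e \<in> out_arcs A v" for e
    using assms(2)[OF that] that by (force simp: descending_def sgn_real_def)
  then show ?thesis
    using True by (simp add: cone_weight_def)
next
  case False
  then obtain e where "e \<in> out_arcs A v" "\<alpha> e \<xi> < 0"
    by (auto simp: descending_def)
  then have "cone_weight A \<alpha> v \<xi> = 0"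
    unfolding cone_weight_def using assms(1) by (intro prod_zero bexI[of _ e]) auto
  then show ?thesis using False by simp
qed

lemma sum_cone_weight_polarized:
  assumes "finite C" "\<And>v. v \<in> C \<Longrightarrow> finite (out_arcs A v)"
    "\<And>v e. v \<in> C \<Longrightarrow> e \<in> out_arcs A v \<Longrightarrow> \<alpha> e \<xi> \<noteq> 0"
  shows "(\<Sum>v\<in>C. cone_weight A \<alpha> v \<xi>) = card {v \<in> C. descending A \<alpha> \<xi> v = {}}"
proof -
  have "(\<Sum>v\<in>C. cone_weight A \<alpha> v \<xi>) = (\<Sum>v\<in>C. of_bool (descending A \<alpha> \<xi> v = {}))"
    using assms by (intro sum.cong refl cone_weight_polarized) auto
  then show ?thesis
    using assms(1) by (simp add: Int_def)
qed

text \<open>Closure under \<open>arev\<close> makes reachability symmetric, so the vertices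
  reachable from a given one span a component.\<close>

lemma sym_digraph_annihilated: "sym_digraph (annihilated \<Gamma> \<alpha> H)"
proof
  show "symmetric (annihilated \<Gamma> \<alpha> H)"
    unfolding symmetric_conv
  proof
    fix e assume "e \<in> arcs (annihilated \<Gamma> \<alpha> H)"
    then show "\<exists>e'\<in>arcs (annihilated \<Gamma> \<alpha> H). tail (annihilated \<Gamma> \<alpha> H) e = head (annihilated \<Gamma> \<alpha> H) e'
        \<and> head (annihilated \<Gamma> \<alpha> H) e = tail (annihilated \<Gamma> \<alpha> H) e'"
      by (intro bexI[of _ "arev e"]) (auto simp: axial_arev_eq_0_iff)
  qed
qed auto

text \<open>NCA2 gives the count 1 for one polarizing vector of the component through
  \<open>q\<close>; invariance of the total \<open>cone_weight\<close> transfers it to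
  \<open>\<xi>\<close>.\<close>

lemma unique_local_minimum:
  assumes nc: "non_cyclic \<Gamma> \<alpha>" and \<xi>: "\<xi> \<in> polarizing \<Gamma> \<alpha>"
    and q: "q \<in> verts \<Gamma>" and e: "e\<^sub>1 \<in> out_arcs \<Gamma> q" "e\<^sub>2 \<in> out_arcs \<Gamma> q" "e\<^sub>1 \<noteq> e\<^sub>2"
  defines "A \<equiv> annihilated \<Gamma> \<alpha> {x. \<alpha> e\<^sub>1 x = 0 \<and> \<alpha> e\<^sub>2 x = 0}"
  shows "\<exists>m. {v. q \<rightarrow>\<^sup>*\<^bsub>A\<^esub> v \<and> descending A \<alpha> \<xi> v = {}} = {m}"
proof -
  define H where "H = {x. \<alpha> e\<^sub>1 x = 0 \<and> \<alpha> e\<^sub>2 x = 0}"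
  have A: "A = annihilated \<Gamma> \<alpha> H"
    by (simp add: A_def H_def)
  interpret A: sym_digraph A
    unfolding A by (rule sym_digraph_annihilated)
  define C where "C = {v. q \<rightarrow>\<^sup>*\<^bsub>A\<^esub> v}"
  define \<Gamma>\<^sub>0 where "\<Gamma>\<^sub>0 = A \<restriction> C"
  have C: "C \<subseteq> verts \<Gamma>"
    using A.reachable_in_verts(2) by (auto simp: C_def A)
  have "q \<in> C"
    using q A.reachable_refl[of q] by (simp add: C_def A)
  have closed: "head \<Gamma> e \<in> C" if "v \<in> C" "e \<in> out_arcs A v" for v e
  proof -
    have "v \<rightarrow>\<^bsub>A\<^esub> head \<Gamma> e"
      using that(2) by (intro A.dominatesI[of e]) (auto simp: A arc_to_ends_def out_arcs_annihilated)
    then show ?thesis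
      using that(1) A.reachable_adj_trans by (auto simp: C_def)
  qed
  have out: "out_arcs \<Gamma>\<^sub>0 v = out_arcs A v" if "v \<in> C" for v
    using closed[OF that] that by (auto simp: \<Gamma>\<^sub>0_def out_arcs_def A)
  have indep: "\<alpha> e\<^sub>1 \<noteq> c *\<^sub>R \<alpha> e\<^sub>2" "\<alpha> e\<^sub>2 \<noteq> c *\<^sub>R \<alpha> e\<^sub>1" for c
    using A1[OF q e(1,2)] A1[OF q e(2,1)] e(3) by (auto dest!: indep_on_pairD)
  obtain u v where uv: "\<alpha> e\<^sub>1 u = 1" "\<alpha> e\<^sub>2 u = 0" "\<alpha> e\<^sub>1 v = 0" "\<alpha> e\<^sub>2 v = 1"
    by (rule exists_dual_basis[OF indep])
  have "\<Gamma>\<^sub>0 \<in> pre_digraph.sccs A"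
    unfolding \<Gamma>\<^sub>0_def C_def using q by (intro A.induce_reachable_is_in_sccs) (simp add: A)
  then have betti: "even_betti \<Gamma>\<^sub>0 \<alpha> 0 = 1"
    using nc dim_common_kernel[OF uv] unfolding non_cyclic_def A H_def by blast
  \<comment> \<open>The vector that \<open>even_betti\<close> selects. It is polarizing for the
    component because \<open>\<xi>\<close> shows that such vectors exist.\<close>
  define \<xi>' where "\<xi>' = (SOME \<xi>. \<xi> \<in> polarizing \<Gamma>\<^sub>0 \<alpha>)"
  have "\<xi> \<in> polarizing \<Gamma>\<^sub>0 \<alpha>"
    using \<xi> by (auto simp: polarizing_def \<Gamma>\<^sub>0_def A)
  then have "\<xi>' \<in> polarizing \<Gamma>\<^sub>0 \<alpha>"
    unfolding \<xi>'_def by (rule someI)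
  \<comment> \<open>A polarizing vector of the component avoids \<open>H\<close> because
    \<open>e\<^sub>1\<close> is one of its edges and vanishes on \<open>H\<close>.\<close>
  have count: "(\<Sum>v\<in>C. cone_weight A \<alpha> v \<eta>) = card {v \<in> C. descending A \<alpha> \<eta> v = {}}"
    and notin: "\<eta> \<notin> H"
    if \<eta>: "\<eta> \<in> polarizing \<Gamma>\<^sub>0 \<alpha>" for \<eta>
  proof -
    have nz: "\<alpha> e \<eta> \<noteq> 0" if "v \<in> C" "e \<in> out_arcs A v" for v e
    proof -
      have "e \<in> out_arcs \<Gamma>\<^sub>0 v"
        using out[OF that(1)] that(2) by simp
      then show ?thesis
        using \<eta> by (simp add: polarizing_def)
    qed
    show "(\<Sum>v\<in>C. cone_weight A \<alpha> v \<eta>) = card {v \<in> C. descending A \<alpha> \<eta> v = {}}"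
      using nz finite_subset[OF C finite_verts]
      by (intro sum_cone_weight_polarized) (simp_all add: A)
    have "e\<^sub>1 \<in> out_arcs A q"
      using e by (auto simp: A out_arcs_annihilated H_def)
    then show "\<eta> \<notin> H"
      using nz[OF \<open>q \<in> C\<close>] by (auto simp: H_def)
  qed
  have "card {v \<in> C. descending A \<alpha> \<xi>' v = {}} = 1"
  proof -
    have "index \<Gamma>\<^sub>0 \<alpha> \<xi>' v = 0 \<longleftrightarrow> descending A \<alpha> \<xi>' v = {}" if "v \<in> C" for v
    proof -
      have "descending \<Gamma>\<^sub>0 \<alpha> \<xi>' v = descending A \<alpha> \<xi>' v"
        using out[OF that] by (simp add: descending_def)
      moreover have "finite (descending A \<alpha> \<xi>' v)"
        by (simp add: descending_def A)
      ultimately show ?thesis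
        by (simp add: index_def)
    qed
    then have "{v \<in> C. descending A \<alpha> \<xi>' v = {}} = {v \<in> verts \<Gamma>\<^sub>0. index \<Gamma>\<^sub>0 \<alpha> \<xi>' v = 0}"
      by (auto simp: \<Gamma>\<^sub>0_def)
    then show ?thesis
      using betti by (simp add: even_betti_def \<xi>'_def)
  qed
  moreover have "(\<Sum>v\<in>C. cone_weight A \<alpha> v \<xi>) = (\<Sum>v\<in>C. cone_weight A \<alpha> v \<xi>')"
    unfolding A H_def
  proof (rule sum_cone_weight_constant[OF indep C])
    show "head \<Gamma> e \<in> C" if "v \<in> C"
      "e \<in> out_arcs (annihilated \<Gamma> \<alpha> {x. \<alpha> e\<^sub>1 x = 0 \<and> \<alpha> e\<^sub>2 x = 0}) v" for v e
      using closed that by (simp add: A_def)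
    show "\<xi> \<notin> {x. \<alpha> e\<^sub>1 x = 0 \<and> \<alpha> e\<^sub>2 x = 0}" "\<xi>' \<notin> {x. \<alpha> e\<^sub>1 x = 0 \<and> \<alpha> e\<^sub>2 x = 0}"
      using notin[OF \<open>\<xi> \<in> polarizing \<Gamma>\<^sub>0 \<alpha>\<close>] notin[OF \<open>\<xi>' \<in> polarizing \<Gamma>\<^sub>0 \<alpha>\<close>]
      by (simp_all add: H_def)
  qed
  ultimately have "card {v \<in> C. descending A \<alpha> \<xi> v = {}} = 1"
    using count[OF \<open>\<xi> \<in> polarizing \<Gamma>\<^sub>0 \<alpha>\<close>] count[OF \<open>\<xi>' \<in> polarizing \<Gamma>\<^sub>0 \<alpha>\<close>] by simp
  then obtain m where "{v \<in> C. descending A \<alpha> \<xi> v = {}} = {m}"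
    by (rule card_1_singletonE)
  then show ?thesis
    by (auto simp: C_def)
qed

end

section \<open>Construction of the Thom class\<close>

text \<open>Equality on the kernel of \<open>\<alpha> e\<close> stands in for divisibility by
  \<open>\<alpha> e\<close>: it chains along paths and matches the interpolation conditions. Only
  edges with both ends in \<open>D\<close> are tested, so that the class can be built up
  gradually.\<close>

definition class_on ::
    "('v, 'e) pre_digraph \<Rightarrow> ('e \<Rightarrow> 'g::euclidean_space \<Rightarrow>\<^sub>L real) \<Rightarrow> nat \<Rightarrow> 'v set \<Rightarrow>
      ('v \<Rightarrow> 'g \<Rightarrow> real) \<Rightarrow> bool" where
  "class_on \<Gamma> \<alpha> r D f \<longleftrightarrow> (\<forall>v\<in>D. f v \<in> sym_pow r) \<and>
    (\<forall>e\<in>arcs \<Gamma>. tail \<Gamma> e \<in> D \<longrightarrow> head \<Gamma> e \<in> D \<longrightarrow>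
      (\<forall>x. \<alpha> e x = 0 \<longrightarrow> f (tail \<Gamma> e) x = f (head \<Gamma> e) x))"

text \<open>Descending paths from \<open>D\<close> stay where the partial class is already
  controlled. Since heights may tie, such sets, unlike sublevel sets of the height, can grow by one
  vertex at a time.\<close>

definition lower_set ::
    "('v, 'e) pre_digraph \<Rightarrow> ('e \<Rightarrow> 'g::euclidean_space \<Rightarrow>\<^sub>L real) \<Rightarrow> 'g \<Rightarrow> 'v set \<Rightarrow> bool" where
  "lower_set \<Gamma> \<alpha> \<xi> D \<longleftrightarrow> (\<forall>e\<in>arcs \<Gamma>. \<alpha> e \<xi> < 0 \<longrightarrow> tail \<Gamma> e \<in> D \<longrightarrow> head \<Gamma> e \<in> D)"

lemma prod_in_sym_pow:
  fixes \<alpha> :: "'e \<Rightarrow> 'g::euclidean_space \<Rightarrow>\<^sub>L real"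
  assumes "finite S"
  shows "(\<lambda>x. \<Prod>e\<in>S. \<alpha> e x) \<in> sym_pow (card S)"
  using assms by (intro sym_powI) (auto simp: blinfun.scaleR_right prod.distrib)

text \<open>A polarizing vector forces every \<open>\<alpha> e\<close> to be nonzero, so equality on
  kernels becomes divisibility. Restriction to the vertices is there because
  \<open>cohomology\<close> consists of extensional functions.\<close>

lemma class_on_all_imp_even_cohomology:
  assumes "class_on \<Gamma> \<alpha> r (verts \<Gamma>) f" "\<xi> \<in> polarizing \<Gamma> \<alpha>" "wf_digraph \<Gamma>"
  shows "restrict f (verts \<Gamma>) \<in> even_cohomology \<Gamma> \<alpha> r"
proof -
  interpret wf_digraph \<Gamma> by fact
  have f: "f v \<in> sym_pow r" if "v \<in> verts \<Gamma>" for v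
    using assms(1) that by (simp add: class_on_def)
  have "\<exists>g\<in>sym_alg. \<forall>x. f (tail \<Gamma> e) x - f (head \<Gamma> e) x = \<alpha> e x * g x" if e: "e \<in> arcs \<Gamma>" for e
  proof -
    have 1: "\<alpha> e \<noteq> 0"
      using assms(2) e by (auto simp: polarizing_def)
    have 2: "real_polynomial_function (\<lambda>x. f (tail \<Gamma> e) x - f (head \<Gamma> e) x)"
      using e by (intro real_polynomial_function_diff sym_powD(1)[OF f]) auto
    have 3: "f (tail \<Gamma> e) x - f (head \<Gamma> e) x = 0" if "\<alpha> e x = 0" for x
      using assms(1) e that by (simp add: class_on_def)
    obtain g where "real_polynomial_function g"
      "\<And>x. f (tail \<Gamma> e) x - f (head \<Gamma> e) x = \<alpha> e x * g x"
      using divisible_by_functional[OF 1 2 3] by blast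
    then show ?thesis
      by (auto simp: sym_alg_def)
  qed
  moreover have "f v \<in> sym_alg" if "v \<in> verts \<Gamma>" for v
    using f[OF that] by (simp add: sym_pow_def)
  ultimately show ?thesis
    using f by (auto simp: even_cohomology_def cohomology_def)
qed

context one_skeleton
begin

section \<open>Heights and flow-outs\<close>

lemma height_less_of_descending:
  assumes "compatible_height \<Gamma> \<alpha> \<xi> \<phi>" "e \<in> arcs \<Gamma>" "\<alpha> e \<xi> < 0"
  shows "\<phi> (head \<Gamma> e) < \<phi> (tail \<Gamma> e)"
  using assms axial_arev_pos_iff[of e \<xi>] arev_in_arcs[of e]
  unfolding compatible_height_def by (metis head_arev tail_arev)

lemma wf_digraph_ascending: "wf_digraph (ascending \<Gamma> \<alpha> \<xi>)"
  by unfold_locales auto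

text \<open>Read contrapositively: descending edges at a vertex outside the flow-out end outside it,
  which makes 0 a consistent value there.\<close>

lemma flow_out_ascend:
  assumes "e \<in> arcs \<Gamma>" "\<alpha> e \<xi> < 0" "head \<Gamma> e \<in> flow_out \<Gamma> \<alpha> \<xi> p"
  shows "tail \<Gamma> e \<in> flow_out \<Gamma> \<alpha> \<xi> p"
proof -
  interpret A: wf_digraph "ascending \<Gamma> \<alpha> \<xi>"
    by (rule wf_digraph_ascending)
  have "head \<Gamma> e \<rightarrow>\<^bsub>ascending \<Gamma> \<alpha> \<xi>\<^esub> tail \<Gamma> e"
    using assms(1,2) axial_arev_pos_iff[OF assms(1)]
    by (intro A.dominatesI[of "arev e"]) (auto simp: arc_to_ends_def)
  then show ?thesis
    using assms(3) A.reachable_adj_trans by (auto simp: flow_out_def)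
qed

lemma self_in_flow_out: "p \<in> verts \<Gamma> \<Longrightarrow> p \<in> flow_out \<Gamma> \<alpha> \<xi> p"
  using wf_digraph.reachable_refl[OF wf_digraph_ascending[of \<xi>], of p] by (simp add: flow_out_def)

lemma height_le_of_flow_out:
  assumes "compatible_height \<Gamma> \<alpha> \<xi> \<phi>" "q \<in> flow_out \<Gamma> \<alpha> \<xi> p"
  shows "\<phi> p \<le> \<phi> q"
proof -
  interpret A: wf_digraph "ascending \<Gamma> \<alpha> \<xi>"
    by (rule wf_digraph_ascending)
  have "p \<rightarrow>\<^sup>*\<^bsub>ascending \<Gamma> \<alpha> \<xi>\<^esub> q"
    using assms(2) by (simp add: flow_out_def)
  then show ?thesis
  proof (induction rule: A.reachable_induct)
    case base
    then show ?case by simp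
  next
    case (step x y)
    obtain e where "e \<in> arcs \<Gamma>" "\<alpha> e \<xi> > 0" "tail \<Gamma> e = x" "head \<Gamma> e = y"
      using step.hyps(2) by (auto simp: arcs_ends_conv)
    then have "\<phi> x < \<phi> y"
      using assms(1) by (auto simp: compatible_height_def)
    then show ?case
      using step.IH by simp
  qed
qed

text \<open>Descending inside the face spanned by two edges never leaves \<open>D\<close> and ends at the unique
  local minimum of the face, so \<open>f\<close> takes the same value there on the common kernel.\<close>

lemma class_on_face:
  assumes nc: "non_cyclic \<Gamma> \<alpha>" and \<xi>: "\<xi> \<in> polarizing \<Gamma> \<alpha>"
    and \<phi>: "compatible_height \<Gamma> \<alpha> \<xi> \<phi>"
    and D: "D \<subseteq> verts \<Gamma>" "lower_set \<Gamma> \<alpha> \<xi> D" and f: "class_on \<Gamma> \<alpha> r D f"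
    and q: "q \<in> verts \<Gamma>" and e: "e\<^sub>1 \<in> out_arcs \<Gamma> q" "e\<^sub>2 \<in> out_arcs \<Gamma> q" "e\<^sub>1 \<noteq> e\<^sub>2"
    and hd: "head \<Gamma> e\<^sub>1 \<in> D" "head \<Gamma> e\<^sub>2 \<in> D" and x: "\<alpha> e\<^sub>1 x = 0" "\<alpha> e\<^sub>2 x = 0"
  shows "f (head \<Gamma> e\<^sub>1) x = f (head \<Gamma> e\<^sub>2) x"
proof -
  define A where "A = annihilated \<Gamma> \<alpha> {x. \<alpha> e\<^sub>1 x = 0 \<and> \<alpha> e\<^sub>2 x = 0}"
  interpret A: sym_digraph A
    unfolding A_def by (rule sym_digraph_annihilated)
  obtain m where m: "{v. q \<rightarrow>\<^sup>*\<^bsub>A\<^esub> v \<and> descending A \<alpha> \<xi> v = {}} = {m}"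
    using unique_local_minimum[OF nc \<xi> q e] by (auto simp: A_def)
  have step: "q \<rightarrow>\<^sup>*\<^bsub>A\<^esub> head \<Gamma> e" if "q \<rightarrow>\<^sup>*\<^bsub>A\<^esub> v" "e \<in> out_arcs A v" for v e
  proof -
    have "v \<rightarrow>\<^bsub>A\<^esub> head \<Gamma> e"
      using that(2) by (intro A.dominatesI[of e]) (auto simp: A_def arc_to_ends_def)
    then show ?thesis
      using that(1) A.reachable_adj_trans by blast
  qed
  have min: "f v x = f m x" if "v \<in> D" "q \<rightarrow>\<^sup>*\<^bsub>A\<^esub> v" for v
    using that
  \<comment> \<open>In a finite graph the number of lower vertices turns the real-valued height into
    a well-founded measure.\<close>
  proof (induction "card {w \<in> verts \<Gamma>. \<phi> w < \<phi> v}" arbitrary: v rule: less_induct)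
    case less
    show ?case
    proof (cases "descending A \<alpha> \<xi> v = {}")
      case True
      then have "v = m"
        using m less.prems(2) by blast
      then show ?thesis by simp
    next
      case False
      then obtain e where eA: "e \<in> out_arcs A v" and neg: "\<alpha> e \<xi> < 0"
        by (auto simp: descending_def)
      have e: "e \<in> arcs \<Gamma>" "tail \<Gamma> e = v" "\<alpha> e x = 0"
        using eA x by (auto simp: A_def)
      have D': "head \<Gamma> e \<in> D"
        using D(2) e neg less.prems(1) by (auto simp: lower_set_def)
      have lt: "\<phi> (head \<Gamma> e) < \<phi> v"
        using height_less_of_descending[OF \<phi> e(1) neg] e(2) by simp
      have "{w \<in> verts \<Gamma>. \<phi> w < \<phi> (head \<Gamma> e)} \<subseteq> {w \<in> verts \<Gamma>. \<phi> w < \<phi> v}"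
        using lt by auto
      moreover have "head \<Gamma> e \<in> {w \<in> verts \<Gamma>. \<phi> w < \<phi> v} - {w \<in> verts \<Gamma>. \<phi> w < \<phi> (head \<Gamma> e)}"
        using lt e(1) by simp
      ultimately have "{w \<in> verts \<Gamma>. \<phi> w < \<phi> (head \<Gamma> e)} \<subset> {w \<in> verts \<Gamma>. \<phi> w < \<phi> v}"
        by blast
      then have "card {w \<in> verts \<Gamma>. \<phi> w < \<phi> (head \<Gamma> e)} < card {w \<in> verts \<Gamma>. \<phi> w < \<phi> v}"
        by (intro psubset_card_mono) auto
      then have "f (head \<Gamma> e) x = f m x"
        using D' step[OF less.prems(2) eA] by (rule less.hyps)
      \<comment> \<open>The edge is annihilated on the common kernel, which contains
        \<open>x\<close>, so the class does not change across it at \<open>x\<close>.\<close>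
      moreover have "f v x = f (head \<Gamma> e) x"
        using f e D' less.prems(1) unfolding class_on_def by blast
      ultimately show ?thesis by simp
    qed
  qed
  have "q \<rightarrow>\<^sup>*\<^bsub>A\<^esub> q"
    using q by (intro A.reachable_refl) (simp add: A_def)
  moreover have "e\<^sub>1 \<in> out_arcs A q" "e\<^sub>2 \<in> out_arcs A q"
    using e by (auto simp: A_def)
  ultimately show ?thesis
    using min[OF hd(1)] min[OF hd(2)] step by simp
qed

text \<open>No vertex of \<open>D\<close> is higher than \<open>q\<close>, so every edge from
  \<open>q\<close> into \<open>D\<close> descends strictly, and \<open>eq\<close> covers exactly
  these edges.\<close>

lemma class_on_insert:
  assumes \<phi>: "compatible_height \<Gamma> \<alpha> \<xi> \<phi>" and \<xi>: "\<xi> \<in> polarizing \<Gamma> \<alpha>"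
    and max: "\<And>v. v \<in> D \<Longrightarrow> \<phi> v \<le> \<phi> q"
    and f: "class_on \<Gamma> \<alpha> r (D - {q}) f" and g: "g \<in> sym_pow r"
    and eq: "\<And>e x. e \<in> descending \<Gamma> \<alpha> \<xi> q \<Longrightarrow> \<alpha> e x = 0 \<Longrightarrow> g x = f (head \<Gamma> e) x"
  shows "class_on \<Gamma> \<alpha> r D (f(q := g))"
proof -
  have out: "head \<Gamma> e \<noteq> q \<and> e \<in> descending \<Gamma> \<alpha> \<xi> q"
    if e: "e \<in> arcs \<Gamma>" "tail \<Gamma> e = q" "head \<Gamma> e \<in> D" for e
  proof -
    have "\<not> \<alpha> e \<xi> > 0"
      using \<phi> max[OF e(3)] e by (auto simp: compatible_height_def)
    moreover have "\<alpha> e \<xi> \<noteq> 0"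
      using \<xi> e(1) by (simp add: polarizing_def)
    ultimately have "\<alpha> e \<xi> < 0" by simp
    then show ?thesis
      using height_less_of_descending[OF \<phi> e(1)] e by (auto simp: descending_def)
  qed
  have "(f(q := g)) (tail \<Gamma> e) x = (f(q := g)) (head \<Gamma> e) x"
    if e: "e \<in> arcs \<Gamma>" "tail \<Gamma> e \<in> D" "head \<Gamma> e \<in> D" "\<alpha> e x = 0" for e x
  proof -
    consider "tail \<Gamma> e = q" | "head \<Gamma> e = q" | "tail \<Gamma> e \<noteq> q" "head \<Gamma> e \<noteq> q" by blast
    then show ?thesis
    proof cases
      case 1
      then show ?thesis
        using out[OF e(1) 1 e(3)] eq[of e x] e(4) by simp
    next
      case 2
      \<comment> \<open>An edge arriving at \<open>q\<close> is handled through its reversal, which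
        has the same kernel.\<close>
      have "arev e \<in> arcs \<Gamma>" "tail \<Gamma> (arev e) = q" "head \<Gamma> (arev e) = tail \<Gamma> e" "\<alpha> (arev e) x = 0"
        using e(1,4) 2 axial_arev_eq_0_iff by auto
      then show ?thesis
        using out[of "arev e"] eq[of "arev e" x] e(2) 2 by simp
    next
      case 3
      then show ?thesis
        using f e by (simp add: class_on_def)
    qed
  qed
  then show ?thesis
    using f g unfolding class_on_def by auto
qed

text \<open>The nodes are the kernels of the descending edges at \<open>q\<close>. Triples are in
  general position because a form vanishing on the common kernel of two others lies in their span,
  against 3-independence; compatibility on pairs is \<open>class_on_face\<close>.\<close>

lemma class_on_extend:
  assumes ind: "three_independent \<Gamma> \<alpha>" and nc: "non_cyclic \<Gamma> \<alpha>"
    and \<xi>: "\<xi> \<in> polarizing \<Gamma> \<alpha>" and \<phi>: "compatible_height \<Gamma> \<alpha> \<xi> \<phi>"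
    and D: "D \<subseteq> verts \<Gamma>" "lower_set \<Gamma> \<alpha> \<xi> D" and f: "class_on \<Gamma> \<alpha> r D f"
    and q: "q \<in> verts \<Gamma>" and hd: "\<And>e. e \<in> descending \<Gamma> \<alpha> \<xi> q \<Longrightarrow> head \<Gamma> e \<in> D"
  obtains g where "g \<in> sym_pow r"
    "\<And>e x. e \<in> descending \<Gamma> \<alpha> \<xi> q \<Longrightarrow> \<alpha> e x = 0 \<Longrightarrow> g x = f (head \<Gamma> e) x"
proof -
  let ?I = "descending \<Gamma> \<alpha> \<xi> q"
  have out: "e \<in> out_arcs \<Gamma> q" if "e \<in> ?I" for e
    using that by (simp add: descending_def)
  have indep: "\<alpha> i \<noteq> c *\<^sub>R \<alpha> j" if "i \<in> ?I" "j \<in> ?I" "i \<noteq> j" for i j c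
    using that A1[OF q out out] by (intro indep_on_pairD) auto
  have dual: "\<exists>u v. \<alpha> i u = 1 \<and> \<alpha> j u = 0 \<and> \<alpha> i v = 0 \<and> \<alpha> j v = 1"
    if ij: "i \<in> ?I" "j \<in> ?I" "i \<noteq> j" for i j
  proof -
    obtain u v where "\<alpha> i u = 1" "\<alpha> j u = 0" "\<alpha> i v = 0" "\<alpha> j v = 1"
      by (rule exists_dual_basis[OF indep[OF ij] indep[OF ij(2,1) ij(3)[symmetric]]])
    then show ?thesis by blast
  qed
  show ?thesis
  proof (rule homogeneous_interpolation[where I = ?I and \<alpha> = \<alpha> and f = "\<lambda>e. f (head \<Gamma> e)" and m = r])
    show "finite ?I"
      by (simp add: descending_def)
    show "\<exists>u. \<alpha> i u = 0 \<and> \<alpha> j u = 1" if "i \<in> ?I" "j \<in> ?I" "i \<noteq> j" for i j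
      using dual[OF that] by blast
    show "\<exists>w. \<alpha> i w = 0 \<and> \<alpha> j w = 0 \<and> \<alpha> k w \<noteq> 0"
      if ijk: "i \<in> ?I" "j \<in> ?I" "k \<in> ?I" "i \<noteq> j" "i \<noteq> k" "j \<noteq> k" for i j k
    proof (rule ccontr)
      assume "\<nexists>w. \<alpha> i w = 0 \<and> \<alpha> j w = 0 \<and> \<alpha> k w \<noteq> 0"
      then have van: "\<alpha> k w = 0" if "\<alpha> i w = 0" "\<alpha> j w = 0" for w
        using that by blast
      obtain u v where uv: "\<alpha> i u = 1" "\<alpha> j u = 0" "\<alpha> i v = 0" "\<alpha> j v = 1"
        using dual[OF ijk(1,2,4)] by blast
      have "\<alpha> k = \<alpha> k u *\<^sub>R \<alpha> i + \<alpha> k v *\<^sub>R \<alpha> j"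
        using uv van by (rule functional_in_span2)
      moreover have "{k, i, j} \<subseteq> out_arcs \<Gamma> q" "card {k, i, j} = 3"
        using out ijk by auto
      then have "indep_on \<alpha> {k, i, j}"
        using ind q unfolding three_independent_def by blast
      then have "\<alpha> k \<noteq> \<alpha> k u *\<^sub>R \<alpha> i + \<alpha> k v *\<^sub>R \<alpha> j"
        using ijk by (intro indep_on_tripleD) auto
      ultimately show False by contradiction
    qed
    show "f (head \<Gamma> i) \<in> sym_pow r" if "i \<in> ?I" for i
      using f hd[OF that] by (simp add: class_on_def)
    show "f (head \<Gamma> i) x = f (head \<Gamma> j) x"
      if "i \<in> ?I" "j \<in> ?I" "i \<noteq> j" "\<alpha> i x = 0" "\<alpha> j x = 0" for i j x
      by (rule class_on_face[OF nc \<xi> \<phi> D f q out[OF that(1)] out[OF that(2)] that(3)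
            hd[OF that(1)] hd[OF that(2)] that(4,5)])
  qed (rule that; blast)
qed

text \<open>Induction on \<open>D\<close>, removing a vertex \<open>q\<close> of maximal height. The
  value at \<open>q\<close> is 0 outside the flow-out, the prescribed product at \<open>p\<close>,
  and an interpolant elsewhere.\<close>

lemma thom_class_on_lower_set:
  assumes ind: "three_independent \<Gamma> \<alpha>" and nc: "non_cyclic \<Gamma> \<alpha>"
    and \<xi>: "\<xi> \<in> polarizing \<Gamma> \<alpha>" and \<phi>: "compatible_height \<Gamma> \<alpha> \<xi> \<phi>"
    and p: "p \<in> verts \<Gamma>" and r: "index \<Gamma> \<alpha> \<xi> p = r"
    and D: "D \<subseteq> verts \<Gamma>" "lower_set \<Gamma> \<alpha> \<xi> D"
  shows "\<exists>f. class_on \<Gamma> \<alpha> r D f \<and> (\<forall>v\<in>D - flow_out \<Gamma> \<alpha> \<xi> p. f v = (\<lambda>x. 0)) \<and>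
    (p \<in> D \<longrightarrow> f p = (\<lambda>x. \<Prod>e\<in>descending \<Gamma> \<alpha> \<xi> p. \<alpha> e x))"
proof -
  let ?F = "flow_out \<Gamma> \<alpha> \<xi> p" and ?t = "\<lambda>x. \<Prod>e\<in>descending \<Gamma> \<alpha> \<xi> p. \<alpha> e x"
  have "finite D"
    using D(1) finite_verts finite_subset by blast
  then show ?thesis
    using D
  proof (induction D rule: finite_psubset_induct)
    case (psubset D)
    show ?case
    proof (cases "D = {}")
      case True
      then show ?thesis by (auto simp: class_on_def)
    next
      case False
      have "Max (\<phi> ` D) \<in> \<phi> ` D"
        using psubset.hyps False by (intro Max_in) auto
      then obtain q where q: "q \<in> D" "\<phi> q = Max (\<phi> ` D)" by auto
      then have max: "\<phi> v \<le> \<phi> q" if "v \<in> D" for v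
        using psubset.hyps that by simp
      let ?D = "D - {q}"
      have D': "?D \<subseteq> verts \<Gamma>" "lower_set \<Gamma> \<alpha> \<xi> ?D"
      proof -
        show "?D \<subseteq> verts \<Gamma>" using psubset.prems by blast
        \<comment> \<open>The head of a descending edge is strictly lower than its tail, so it
          cannot be a highest vertex.\<close>
        have "head \<Gamma> e \<noteq> q" if "e \<in> arcs \<Gamma>" "\<alpha> e \<xi> < 0" "tail \<Gamma> e \<in> D" for e
          using height_less_of_descending[OF \<phi> that(1,2)] max[OF that(3)] by auto
        then show "lower_set \<Gamma> \<alpha> \<xi> ?D"
          using psubset.prems(2) by (auto simp: lower_set_def)
      qed
      have qV: "q \<in> verts \<Gamma>" using q psubset.prems by blast
      have hd: "head \<Gamma> e \<in> ?D" if "e \<in> descending \<Gamma> \<alpha> \<xi> q" for e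
        using that q psubset.prems(2) height_less_of_descending[OF \<phi>, of e]
        by (auto simp: descending_def lower_set_def)
      have "?D \<subset> D" using q by blast
      then obtain f where f: "class_on \<Gamma> \<alpha> r ?D f" "\<And>v. v \<in> ?D - ?F \<Longrightarrow> f v = (\<lambda>x. 0)"
        "p \<in> ?D \<Longrightarrow> f p = ?t"
        using psubset.IH[OF _ D'] by blast
      have "\<exists>g\<in>sym_pow r. (\<forall>e\<in>descending \<Gamma> \<alpha> \<xi> q. \<forall>x. \<alpha> e x = 0 \<longrightarrow> g x = f (head \<Gamma> e) x) \<and>
          (q \<notin> ?F \<longrightarrow> g = (\<lambda>x. 0)) \<and> (q = p \<longrightarrow> g = ?t)"
      proof -
        consider "q \<notin> ?F" | "q = p" | "q \<in> ?F" "q \<noteq> p" by blast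
        then show ?thesis
        proof cases
          case 1
          have "f (head \<Gamma> e) x = 0" if "e \<in> descending \<Gamma> \<alpha> \<xi> q" for e x
          proof -
            have "head \<Gamma> e \<notin> ?F"
              using flow_out_ascend[of e \<xi> p] 1 that by (auto simp: descending_def)
            then show ?thesis
              using f(2) hd[OF that] by auto
          qed
          moreover have "(\<lambda>x. 0) \<in> sym_pow r"
            by (rule sym_powI) auto
          moreover have "q \<noteq> p"
            using 1 self_in_flow_out[OF p] by blast
          ultimately show ?thesis by auto
        next
          case 2
          have fin: "finite (descending \<Gamma> \<alpha> \<xi> p)"
            by (simp add: descending_def)
          \<comment> \<open>Lower neighbours of \<open>p\<close> lie outside its flow-out, so the
            class is 0 there; on the kernel of a descending edge the product has a zero
            factor.\<close>
          have "?t x = f (head \<Gamma> e) x" if e: "e \<in> descending \<Gamma> \<alpha> \<xi> p" "\<alpha> e x = 0" for e x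
          proof -
            have "\<phi> (head \<Gamma> e) < \<phi> p"
              using height_less_of_descending[OF \<phi>, of e] e by (auto simp: descending_def)
            then have "head \<Gamma> e \<notin> ?F"
              using height_le_of_flow_out[OF \<phi>] by force
            then have "f (head \<Gamma> e) x = 0"
              using f(2) hd e(1) 2 by auto
            moreover have "?t x = 0"
              using fin e by (intro prod_zero) auto
            ultimately show ?thesis by simp
          qed
          moreover have "?t \<in> sym_pow r"
            using prod_in_sym_pow[OF fin] r by (simp add: index_def)
          ultimately show ?thesis
            unfolding 2 using self_in_flow_out[OF p, of \<xi>] by (intro bexI[of _ ?t] conjI; blast)
        next
          case 3
          obtain g where "g \<in> sym_pow r"
            "\<And>e x. e \<in> descending \<Gamma> \<alpha> \<xi> q \<Longrightarrow> \<alpha> e x = 0 \<Longrightarrow> g x = f (head \<Gamma> e) x"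
            using class_on_extend[OF ind nc \<xi> \<phi> D' f(1) qV hd] by blast
          then show ?thesis using 3 by blast
        qed
      qed
      then obtain g where g: "g \<in> sym_pow r"
        "\<And>e x. e \<in> descending \<Gamma> \<alpha> \<xi> q \<Longrightarrow> \<alpha> e x = 0 \<Longrightarrow> g x = f (head \<Gamma> e) x"
        "q \<notin> ?F \<Longrightarrow> g = (\<lambda>x. 0)" "q = p \<Longrightarrow> g = ?t"
        by blast
      have "class_on \<Gamma> \<alpha> r D (f(q := g))"
        by (rule class_on_insert[OF \<phi> \<xi> max f(1) g(1,2)])
      moreover have "(f(q := g)) v = (\<lambda>x. 0)" if "v \<in> D - ?F" for v
        using f(2)[of v] g(3) that by (cases "v = q") auto
      moreover have "(f(q := g)) p = ?t" if "p \<in> D"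
        using f(3) g(4) that by simp
      ultimately show ?thesis by blast
    qed
  qed
qed

end

theorem theorem2p4p2:
  fixes \<Gamma> :: "('v, 'e) pre_digraph"
    and arev :: "'e \<Rightarrow> 'e"
    and d :: nat
    and \<theta> :: "'e \<Rightarrow> 'e \<Rightarrow> 'e"
    and \<alpha> :: "'e \<Rightarrow> 'g::euclidean_space \<Rightarrow>\<^sub>L real"
    and \<xi> :: 'g
    and \<phi> :: "'v \<Rightarrow> real"
    and p :: 'v
    and r :: nat
  assumes "one_skeleton \<Gamma> arev d \<theta> \<alpha>"
    and "three_independent \<Gamma> \<alpha>"
    and "non_cyclic \<Gamma> \<alpha>"
    and "\<xi> \<in> polarizing \<Gamma> \<alpha>"
    and "compatible_height \<Gamma> \<alpha> \<xi> \<phi>"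
    and "p \<in> verts \<Gamma>"
    and "index \<Gamma> \<alpha> \<xi> p = r"
  shows "\<exists>\<tau> \<in> even_cohomology \<Gamma> \<alpha> r.
    (\<forall>q \<in> verts \<Gamma> - flow_out \<Gamma> \<alpha> \<xi> p. \<tau> q = (\<lambda>x. 0)) \<and>
    \<tau> p = (\<lambda>x. \<Prod>e \<in> descending \<Gamma> \<alpha> \<xi> p. blinfun_apply (\<alpha> e) x)"
proof -
  interpret one_skeleton \<Gamma> arev d \<theta> \<alpha> by fact
  \<comment> \<open>On the full vertex set a partial class becomes a class on the whole
    graph.\<close>
  have "lower_set \<Gamma> \<alpha> \<xi> (verts \<Gamma>)"
    by (simp add: lower_set_def)
  then obtain f where f: "class_on \<Gamma> \<alpha> r (verts \<Gamma>) f"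
    "\<And>v. v \<in> verts \<Gamma> - flow_out \<Gamma> \<alpha> \<xi> p \<Longrightarrow> f v = (\<lambda>x. 0)"
    "f p = (\<lambda>x. \<Prod>e\<in>descending \<Gamma> \<alpha> \<xi> p. \<alpha> e x)"
    using thom_class_on_lower_set[OF assms(2-7) subset_refl] assms(6) by blast
  show ?thesis
  proof (intro bexI conjI ballI)
    show "restrict f (verts \<Gamma>) \<in> even_cohomology \<Gamma> \<alpha> r"
      by (rule class_on_all_imp_even_cohomology[OF f(1) assms(4) wf_digraph])
  qed (use f assms(6) in auto)
qed

end
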